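(* Let $K$ be a field. For each $n\in\mathbb{Z}_{\geq 0}$ the $\mathbf{Fin}^{\mathrm{op}}$-algebra $A_n/I_n$ (the coordinate ring of the $\mathbf{Fin}$-variety $Q_n^{\leq 1}$ of rank-one tensors) is Noetherian.
   Context: Algebras are associative, commutative $K$-algebras with $1$, and homomorphisms preserve $1$. $\mathbf{Fin}$ is the category of all finite sets with all maps as morphisms. A $\mathbf{Fin}^{\mathrm{op}}$-algebra $B$ is a contravariant functor from $\mathbf{Fin}$ to algebras: it assigns to each finite set $S$ an algebra $B(S)$ and to each map $\pi:S\to T$ an algebra homomorphism $\pi^*:B(T)\to B(S)$. An ideal $I$ in $B$ assigns to each finite set $S$ an ideal $I(S)$ of $B(S)$ such that $\pi^*(I(T))\subseteq I(S)$ for each $\pi:S\to T$; the quotient $B/I$ is $S\mapsto B(S)/I(S)$. The ideal generated by elements $b_j\in B(S_j)$, $j\in J$, is given by $I(S)=(\pi^*(b_j)\mid j\in J,\ \pi:S\to S_j\text{ a map})$. $B$ is Noetherian if each ideal in it is generated by finitely many elements in various $I(S_j)$ (i.e. $J$ can be taken finite). $A_n$ is the $\mathbf{Fin}^{\mathrm{op}}$-algebra $A_n(S)=K[x_\alpha\mid\alpha\in[n]^S]$, with $[n]=\{1,\ldots,n\}$, where $\pi:S\to T$ induces $\pi^*:A_n(T)\to A_n(S)$, $x_\alpha\mapsto x_{\alpha\circ\pi}$. It is the coordinate ring of $S\mapsto Q_n(S)=(K^n)^{\otimes S}$. $I_n$ is the ideal in $A_n$ such that $I_n(S)$ is generated by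 all binomials $$x_{\alpha_1||\alpha_2}x_{\beta_1||\beta_2}-x_{\alpha_1||\beta_2}x_{\beta_1||\alpha_2},$$ over all partitions of $S$ into two parts $S_1,S_2$ and all $\alpha_i,\beta_i\in[n]^{S_i}$, where $\alpha_1||\alpha_2\in[n]^S$ denotes the element that equals $\alpha_i$ on $S_i$. (If $K$ is infinite, $I_n(S)$ is the vanishing ideal of the variety $Q_n^{\leq 1}(S)$ of tensors of the form $\otimes_{i\in S}v_i$, $v_i\in K^n$.) *)

theory Defs
  imports
    "HOL-Algebra.Algebra"
    "HOL-Algebra.Algebraic_Closure_Type"
    "HOL-Library.Poly_Mapping"
    "HOL-Library.Infinite_Typeclass"
begin

section \<open>Contravariant functors from finite sets to algebras\<close>

text \<open>
  The objects of Fin are the finite subsets of a type \<open>'s\<close>, and the morphisms \<open>S \<rightarrow> T\<close> are the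
  extensional functions in \<open>S \<rightarrow>\<^sub>E T\<close>.  If \<open>'s\<close> is infinite, it contains a copy of every
  finite set, so this is the category of finite sets up to equivalence.

  \<open>B S\<close> is the algebra at \<open>S\<close> and \<open>pull S T \<pi> : B T \<rightarrow> B S\<close> is the map \<open>\<pi>\<^sup>*\<close>.  Values
  of \<open>B\<close> and \<open>pull\<close> at infinite sets are irrelevant.
\<close>

locale fin_op_algebra =
  fixes K :: "('k, 'm) ring_scheme"
    and B :: "'s set \<Rightarrow> ('k, 'b) module"
    and pull :: "'s set \<Rightarrow> 's set \<Rightarrow> ('s \<Rightarrow> 's) \<Rightarrow> 'b \<Rightarrow> 'b"
  assumes algebra: "finite S \<Longrightarrow> algebra K (B S)"
    and pull_hom: "\<lbrakk>finite S; finite T; \<pi> \<in> S \<rightarrow>\<^sub>E T\<rbrakk> \<Longrightarrow> pull S T \<pi> \<in> ring_hom (B T) (B S)"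
    and pull_smult: "\<lbrakk>finite S; finite T; \<pi> \<in> S \<rightarrow>\<^sub>E T; c \<in> carrier K; b \<in> carrier (B T)\<rbrakk> \<Longrightarrow>
      pull S T \<pi> (c \<odot>\<^bsub>B T\<^esub> b) = c \<odot>\<^bsub>B S\<^esub> pull S T \<pi> b"
    and pull_id: "\<lbrakk>finite S; b \<in> carrier (B S)\<rbrakk> \<Longrightarrow> pull S S (\<lambda>s\<in>S. s) b = b"
    and pull_compose: "\<lbrakk>finite S; finite T; finite U; \<pi> \<in> S \<rightarrow>\<^sub>E T; \<rho> \<in> T \<rightarrow>\<^sub>E U; b \<in> carrier (B U)\<rbrakk> \<Longrightarrow>
      pull S U (compose S \<rho> \<pi>) b = pull S T \<pi> (pull T U \<rho> b)"

definition fin_op_ideal ::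
  "('s set \<Rightarrow> ('k, 'b) module) \<Rightarrow> ('s set \<Rightarrow> 's set \<Rightarrow> ('s \<Rightarrow> 's) \<Rightarrow> 'b \<Rightarrow> 'b) \<Rightarrow> ('s set \<Rightarrow> 'b set) \<Rightarrow> bool"
  where "fin_op_ideal B pull I \<longleftrightarrow>
    (\<forall>S. finite S \<longrightarrow> ideal (I S) (B S)) \<and>
    (\<forall>S T. finite S \<longrightarrow> finite T \<longrightarrow> (\<forall>\<pi>\<in>S \<rightarrow>\<^sub>E T. pull S T \<pi> ` I T \<subseteq> I S))"

text \<open>A pair \<open>(T, b) \<in> G\<close> stands for the generator \<open>b \<in> B(T)\<close>.\<close>

definition fin_op_genideal ::
  "('s set \<Rightarrow> ('k, 'b) module) \<Rightarrow> ('s set \<Rightarrow> 's set \<Rightarrow> ('s \<Rightarrow> 's) \<Rightarrow> 'b \<Rightarrow> 'b) \<Rightarrow> ('s set \<times> 'b) set \<Rightarrow>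
    's set \<Rightarrow> 'b set"
  where "fin_op_genideal B pull G S = Idl\<^bsub>B S\<^esub> {pull S T \<pi> b |T b \<pi>. (T, b) \<in> G \<and> \<pi> \<in> S \<rightarrow>\<^sub>E T}"

locale noetherian_fin_op_algebra = fin_op_algebra +
  assumes finitely_generated: "fin_op_ideal B pull I \<Longrightarrow>
    \<exists>G. finite G \<and> (\<forall>(T, b)\<in>G. finite T \<and> b \<in> carrier (B T)) \<and>
      (\<forall>S. finite S \<longrightarrow> I S = fin_op_genideal B pull G S)"

text \<open>
  The unions below run over the representatives of a coset, as in \<^const>\<open>rcoset_mult\<close>; for an
  ideal \<open>I\<close> each of them is a single coset.
\<close>

definition fin_op_quot :: "('s set \<Rightarrow> ('k, 'b) module) \<Rightarrow> ('s set \<Rightarrow> 'b set) \<Rightarrow> 's set \<Rightarrow> ('k, 'b set) module"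
  where "fin_op_quot B I S =
    ring.extend (B S Quot I S) (module.fields (\<lambda>c C. \<Union>b\<in>C. I S +>\<^bsub>B S\<^esub> (c \<odot>\<^bsub>B S\<^esub> b)))"

definition quot_pull ::
  "('s set \<Rightarrow> ('k, 'b) module) \<Rightarrow> ('s set \<Rightarrow> 's set \<Rightarrow> ('s \<Rightarrow> 's) \<Rightarrow> 'b \<Rightarrow> 'b) \<Rightarrow> ('s set \<Rightarrow> 'b set) \<Rightarrow>
    's set \<Rightarrow> 's set \<Rightarrow> ('s \<Rightarrow> 's) \<Rightarrow> 'b set \<Rightarrow> 'b set"
  where "quot_pull B pull I S T \<pi> C = (\<Union>b\<in>C. I S +>\<^bsub>B S\<^esub> pull S T \<pi> b)"


section \<open>Polynomial algebras\<close>

text \<open>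
  Polynomials with coefficients in \<open>'k\<close> and variables from \<open>'v\<close> are finitely supported functions on
  monomials, which are themselves finitely supported exponent functions \<open>'v \<Rightarrow>\<^sub>0 nat\<close>.
\<close>

type_synonym ('v, 'k) mpoly = "('v \<Rightarrow>\<^sub>0 nat) \<Rightarrow>\<^sub>0 'k"

definition const_mpoly :: "'k::field \<Rightarrow> ('v, 'k) mpoly"
  where "const_mpoly c = Poly_Mapping.single 0 c"

definition var_mpoly :: "'v \<Rightarrow> ('v, 'k::field) mpoly"
  where "var_mpoly v = Poly_Mapping.single (Poly_Mapping.single v 1) 1"

definition mpoly_algebra :: "'v set \<Rightarrow> ('k::field, ('v, 'k) mpoly) module"
  where "mpoly_algebra V =
    \<lparr>carrier = {p. \<forall>m\<in>Poly_Mapping.keys p. Poly_Mapping.keys m \<subseteq> V},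
     monoid.mult = (*), one = 1, ring.zero = 0, add = (+), module.smult = (\<lambda>c p. const_mpoly c * p)\<rparr>"

definition subst_mpoly :: "('v \<Rightarrow> ('w, 'k) mpoly) \<Rightarrow> ('v, 'k::field) mpoly \<Rightarrow> ('w, 'k) mpoly"
  where "subst_mpoly f p =
    (\<Sum>m\<in>Poly_Mapping.keys p. const_mpoly (Poly_Mapping.lookup p m) *
      (\<Prod>v\<in>Poly_Mapping.keys m. f v ^ Poly_Mapping.lookup m v))"


section \<open>The coordinate rings of tensors and of rank-one tensors\<close>

definition tensor_algebra :: "nat \<Rightarrow> 's set \<Rightarrow> ('k::field, ('s \<Rightarrow> nat, 'k) mpoly) module"
  where "tensor_algebra n S = mpoly_algebra (S \<rightarrow>\<^sub>E {1..n})"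

text \<open>The algebra homomorphism with \<open>x\<^sub>\<alpha> \<mapsto> x\<^bsub>\<alpha> \<circ> \<pi>\<^esub>\<close>.\<close>

definition tensor_pull ::
  "'s set \<Rightarrow> 's set \<Rightarrow> ('s \<Rightarrow> 's) \<Rightarrow> ('s \<Rightarrow> nat, 'k::field) mpoly \<Rightarrow> ('s \<Rightarrow> nat, 'k) mpoly"
  where "tensor_pull S T \<pi> = subst_mpoly (\<lambda>\<alpha>. var_mpoly (compose S \<alpha> \<pi>))"

text \<open>\<open>\<alpha>\<^sub>1||\<alpha>\<^sub>2\<close>, where \<open>\<alpha>\<^sub>1\<close> has domain \<open>S\<^sub>1\<close>\<close>

definition glue :: "'s set \<Rightarrow> ('s \<Rightarrow> nat) \<Rightarrow> ('s \<Rightarrow> nat) \<Rightarrow> 's \<Rightarrow> nat"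
  where "glue S\<^sub>1 \<alpha>\<^sub>1 \<alpha>\<^sub>2 = (\<lambda>s. if s \<in> S\<^sub>1 then \<alpha>\<^sub>1 s else \<alpha>\<^sub>2 s)"

text \<open>A part of the partition may be empty; the binomial is then \<open>0\<close>.\<close>

definition rank_one_ideal :: "nat \<Rightarrow> 's set \<Rightarrow> ('s \<Rightarrow> nat, 'k::field) mpoly set"
  where "rank_one_ideal n S = Idl\<^bsub>tensor_algebra n S\<^esub>
    {var_mpoly (glue S\<^sub>1 \<alpha>\<^sub>1 \<alpha>\<^sub>2) * var_mpoly (glue S\<^sub>1 \<beta>\<^sub>1 \<beta>\<^sub>2)
       - var_mpoly (glue S\<^sub>1 \<alpha>\<^sub>1 \<beta>\<^sub>2) * var_mpoly (glue S\<^sub>1 \<beta>\<^sub>1 \<alpha>\<^sub>2) |S\<^sub>1 S\<^sub>2 \<alpha>\<^sub>1 \<alpha>\<^sub>2 \<beta>\<^sub>1 \<beta>\<^sub>2.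
       S\<^sub>1 \<union> S\<^sub>2 = S \<and> S\<^sub>1 \<inter> S\<^sub>2 = {} \<and>
       \<alpha>\<^sub>1 \<in> S\<^sub>1 \<rightarrow>\<^sub>E {1..n} \<and> \<beta>\<^sub>1 \<in> S\<^sub>1 \<rightarrow>\<^sub>E {1..n} \<and>
       \<alpha>\<^sub>2 \<in> S\<^sub>2 \<rightarrow>\<^sub>E {1..n} \<and> \<beta>\<^sub>2 \<in> S\<^sub>2 \<rightarrow>\<^sub>E {1..n}}"

definition rank_one_algebra :: "nat \<Rightarrow> 's set \<Rightarrow> ('k::field, ('s \<Rightarrow> nat, 'k) mpoly set) module"
  where "rank_one_algebra n = fin_op_quot (tensor_algebra n) (rank_one_ideal n)"

definition rank_one_pull ::
  "nat \<Rightarrow> 's set \<Rightarrow> 's set \<Rightarrow> ('s \<Rightarrow> 's) \<Rightarrow> ('s \<Rightarrow> nat, 'k::field) mpoly set \<Rightarrow> ('s \<Rightarrow> nat, 'k) mpoly set"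
  where "rank_one_pull n = quot_pull (tensor_algebra n) tensor_pull (rank_one_ideal n)"

end

theory Submission
  imports Defs "HOL-Library.Ramsey" "HOL-Library.Extended_Nat"
    "HOL-Library.Function_Algebras" "HOL-Library.Product_Plus"
begin

text \<open>
  Modulo the binomials, a monomial of degree \<open>d\<close> in \<open>A\<^sub>n(S)\<close> is determined by its profile: a word
  indexed by \<open>S\<close> whose letters are vectors in \<open>\<nat>\<^sup>n\<close> with coordinate sum \<open>d\<close>. Pulling back along \<open>\<pi>\<close>
  composes this word with \<open>\<pi>\<close>. Enumerate \<open>S\<close> and compare profiles by degree, then
  lexicographically; this order is compatible with addition and with pullback along surjections
  for which the positions of the first preimages increase. By division with remainder, an ideal
  is generated by finitely many elements as soon as the relation ``\<open>u \<circ> \<pi> \<le> v\<close> for such a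
  surjection \<open>\<pi>\<close>'' is a well-quasi-order on words.

  That relation is handled with a minimal bad sequence, chosen among the sequences whose
  letters generate a decreasing chain of up-sets of \<open>\<nat>\<^sup>n\<close>: this condition guarantees that a letter
  removed from a word can be sent by \<open>\<pi>\<close> to some letter below it. It is no restriction because every
  sequence of up-sets of \<open>\<nat>\<^sup>n\<close> has a decreasing subsequence (Maclagan).
\<close>


section \<open>Well-quasi-orders on words\<close>

text \<open>Higman's lemma does not give the required order on words. There the unmatched letters of
  the longer word are unconstrained; here \<pi> is defined on all of the larger set, so each of them
  must dominate a letter of the shorter word. For instance (1,0) embeds into (1,0)(0,1), but no
  \<pi> sends the second position to a letter below (0,1). A strict total order on profiles cannot
  respect all pullbacks: a transposition of \<open>S\<close> that moves a profile a to b also moves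
  b to a, so it would turn a < b into b < a. Hence the enumeration and the restricted class of
  surjections. Division along these maps is legitimate because an ideal contains all pullbacks of
  its elements. Profiles make divisibility a coordinatewise condition: if the degrees are ordered
  and the letters of the pulled back profile lie below those of the other one, then all letters of
  the difference have the same sum, so the difference is itself the profile of a monomial.\<close>

definition wqo :: "('a \<Rightarrow> 'a \<Rightarrow> bool) \<Rightarrow> bool"
  where "wqo R \<longleftrightarrow> (\<forall>s. \<exists>\<phi>::nat \<Rightarrow> nat. strict_mono \<phi> \<and> (\<forall>i j. i < j \<longrightarrow> R (s (\<phi> i)) (s (\<phi> j))))"

lemma wqoD:
  fixes s :: "nat \<Rightarrow> 'a"
  assumes "wqo R"
  shows "\<exists>\<phi>::nat \<Rightarrow> nat. strict_mono \<phi> \<and> (\<forall>i j. i < j \<longrightarrow> R (s (\<phi> i)) (s (\<phi> j)))"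
  using assms unfolding wqo_def by (rule spec)

text \<open>Ramsey's theorem: an infinite set of indices on which \<open>R\<close> fails for all
  pairs would be a sequence without a good pair.\<close>

lemma wqoI_good:
  assumes good: "\<And>s::nat \<Rightarrow> 'a. \<exists>i j. i < j \<and> R (s i) (s j)"
  shows "wqo R"
  unfolding wqo_def
proof
  fix s :: "nat \<Rightarrow> 'a"
  \<comment> \<open>Ramsey colours unordered pairs; \<open>Min\<close> and \<open>Max\<close>
    recover the order of the two indices.\<close>
  define f :: "nat set \<Rightarrow> nat" where "f A = (if R (s (Min A)) (s (Max A)) then 1 else 0)" for A
  have "\<forall>x\<in>UNIV. \<forall>y\<in>UNIV. x \<noteq> y \<longrightarrow> f {x, y} < 2"
    by (simp add: f_def)
  from Ramsey2[OF infinite_UNIV_nat this]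
  obtain Y t where Y: "infinite Y" and t: "\<And>x y. x \<in> Y \<Longrightarrow> y \<in> Y \<Longrightarrow> x \<noteq> y \<Longrightarrow> f {x, y} = t"
    by metis
  define \<phi> where "\<phi> = enumerate Y"
  have mono: "strict_mono \<phi>"
    using Y by (simp add: \<phi>_def strict_mono_enumerate)
  have in_Y: "\<phi> i \<in> Y" for i
    using Y by (simp add: \<phi>_def enumerate_in_set)
  have f_phi: "f {\<phi> i, \<phi> j} = t" if "i < j" for i j
  proof -
    have "\<phi> i < \<phi> j" using mono that by (simp add: strict_mono_less)
    then show ?thesis using t in_Y by simp
  qed
  have f_iff: "f {\<phi> i, \<phi> j} = 1 \<longleftrightarrow> R (s (\<phi> i)) (s (\<phi> j))" if "i < j" for i j
  proof -
    have "\<phi> i < \<phi> j" using mono that by (simp add: strict_mono_less)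
    then show ?thesis by (simp add: f_def min_def max_def)
  qed
  obtain i j where "i < j" "R (s (\<phi> i)) (s (\<phi> j))"
    using good[of "\<lambda>i. s (\<phi> i)"] by blast
  then have "t = 1" using f_iff f_phi by metis
  then show "\<exists>\<phi>::nat \<Rightarrow> nat. strict_mono \<phi> \<and> (\<forall>i j. i < j \<longrightarrow> R (s (\<phi> i)) (s (\<phi> j)))"
    using mono f_iff f_phi by (intro exI[of _ \<phi>]) auto
qed

lemma wqo_le_wellorder: "wqo ((\<le>) :: 'a::wellorder \<Rightarrow> 'a \<Rightarrow> bool)"
proof (rule wqoI_good)
  fix s :: "nat \<Rightarrow> 'a"
  define x where "x = (LEAST x. x \<in> range s)"
  have "x \<in> range s" unfolding x_def by (rule LeastI_ex) auto
  then obtain i where "x = s i" by auto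
  moreover have "x \<le> s (Suc i)" unfolding x_def by (rule Least_le) auto
  ultimately show "\<exists>i j. i < j \<and> s i \<le> s j"
    by (intro exI[of _ i] exI[of _ "Suc i"]) simp
qed

lemma wqo_conj:
  fixes f :: "'c \<Rightarrow> 'a" and g :: "'c \<Rightarrow> 'b"
  assumes "wqo R" "wqo Q"
  shows "wqo (\<lambda>x y. R (f x) (f y) \<and> Q (g x) (g y))"
  unfolding wqo_def
proof
  fix s :: "nat \<Rightarrow> 'c"
  obtain \<phi> :: "nat \<Rightarrow> nat" where \<phi>: "strict_mono \<phi>" "\<forall>i j. i < j \<longrightarrow> R (f (s (\<phi> i))) (f (s (\<phi> j)))"
    using wqoD[OF assms(1), of "\<lambda>i. f (s i)"] by blast
  obtain \<psi> :: "nat \<Rightarrow> nat" where \<psi>: "strict_mono \<psi>" "\<forall>i j. i < j \<longrightarrow> Q (g (s (\<phi> (\<psi> i)))) (g (s (\<phi> (\<psi> j))))"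
    using wqoD[OF assms(2), of "\<lambda>i. g (s (\<phi> i))"] by blast
  show "\<exists>\<phi>::nat \<Rightarrow> nat. strict_mono \<phi> \<and> (\<forall>i j. i < j \<longrightarrow> R (f (s (\<phi> i))) (f (s (\<phi> j))) \<and> Q (g (s (\<phi> i))) (g (s (\<phi> j))))"
  proof (intro exI[of _ "\<phi> \<circ> \<psi>"] conjI allI impI)
    show "strict_mono (\<phi> \<circ> \<psi>)" using \<phi>(1) \<psi>(1) by (rule strict_mono_o)
    fix i j :: nat assume "i < j"
    then have "\<psi> i < \<psi> j" using \<psi>(1) by (simp add: strict_mono_less)
    then show "R (f (s ((\<phi> \<circ> \<psi>) i))) (f (s ((\<phi> \<circ> \<psi>) j)))" "Q (g (s ((\<phi> \<circ> \<psi>) i))) (g (s ((\<phi> \<circ> \<psi>) j)))"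
      using \<phi>(2) \<psi>(2) \<open>i < j\<close> by simp_all
  qed
qed

text \<open>Dickson's lemma. It is applied to letters with entries in \<open>nat\<close> and to
  boxes with sides in \<open>enat\<close>, hence the general well-order.\<close>

lemma wqo_pointwise:
  assumes "finite I"
  shows "wqo (\<lambda>a b :: 'i \<Rightarrow> 'a::wellorder. \<forall>i\<in>I. a i \<le> b i)"
  using assms
proof (induction I)
  case empty
  then show ?case unfolding wqo_def by (auto intro!: exI[of _ id] simp: strict_mono_id)
next
  case (insert k I)
  show ?case
    using wqo_conj[OF wqo_le_wellorder insert.IH, of "\<lambda>a. a k" "\<lambda>a. a"] by (simp add: insert_iff)
qed

text \<open>Otherwise any finite set of earlier choices misses an element of \<open>W\<close>, and
  dependent choice produces a sequence without a good pair.\<close>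

lemma wqo_finite_basis:
  assumes "wqo R"
  shows "\<exists>W\<^sub>0\<subseteq>W. finite W\<^sub>0 \<and> (\<forall>w\<in>W. \<exists>w\<^sub>0\<in>W\<^sub>0. R w\<^sub>0 w)"
proof (rule ccontr)
  assume contra: "\<not> ?thesis"
  have "\<exists>s. \<forall>n::nat. s n \<in> W \<and> (\<forall>i<n. \<not> R (s i) (s n))"
  proof (rule dependent_wellorder_choice)
    fix n :: nat and s
    assume "\<And>m. m < n \<Longrightarrow> s m \<in> W \<and> (\<forall>i<m. \<not> R (s i) (s m))"
    then have "s ` {..<n} \<subseteq> W" "finite (s ` {..<n})" by auto
    then obtain w where "w \<in> W" "\<forall>w\<^sub>0\<in>s ` {..<n}. \<not> R w\<^sub>0 w" using contra by metis
    then show "\<exists>w. w \<in> W \<and> (\<forall>i<n. \<not> R (s i) w)" by auto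
  qed auto
  then obtain s :: "nat \<Rightarrow> 'a" where s: "\<And>n i. i < n \<Longrightarrow> \<not> R (s i) (s n)" by blast
  obtain \<phi> :: "nat \<Rightarrow> nat" where "strict_mono \<phi>" "\<forall>i j. i < j \<longrightarrow> R (s (\<phi> i)) (s (\<phi> j))"
    using wqoD[OF assms, of s] by blast
  then have "R (s (\<phi> 0)) (s (\<phi> 1))" "\<phi> 0 < \<phi> 1" by (simp_all add: strict_mono_less)
  then show False using s by blast
qed

text \<open>Nash-Williams' argument inside the class of sequences that satisfy \<open>C\<close>
  pairwise. A trivial \<open>C\<close> gives results of Higman type; a nontrivial one weakens the
  assumption \<open>skip\<close>, which may then exploit what \<open>C\<close> says about the
  dropped letter \<open>b\<close>.\<close>

lemma wqo_lists:
  fixes R C :: "'a list \<Rightarrow> 'a list \<Rightarrow> bool"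
  assumes below: "wqo below" and C: "wqo C"
    and C_tl: "\<And>u b v. C u (b # v) \<Longrightarrow> C u v"
    and nil: "\<And>v. C [] v \<Longrightarrow> R [] v"
    and skip: "\<And>u b v. C u (b # v) \<Longrightarrow> R u v \<Longrightarrow> R u (b # v)"
    and keep: "\<And>a b u v. below a b \<Longrightarrow> R u v \<Longrightarrow> R (a # u) (b # v)"
  shows "wqo R"
proof (rule wqoI_good, rule ccontr)
  fix s :: "nat \<Rightarrow> 'a list"
  assume not_good: "\<not> (\<exists>i j. i < j \<and> R (s i) (s j))"
  define bad where "bad s \<longleftrightarrow> (\<forall>i j. i < j \<longrightarrow> C (s i) (s j) \<and> \<not> R (s i) (s j))" for s :: "nat \<Rightarrow> 'a list"
  define minimal_at where "minimal_at n s \<longleftrightarrow>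
    bad s \<and> (\<forall>t. bad t \<and> (\<forall>i<n. t i = s i) \<longrightarrow> length (s n) \<le> length (t n))" for n s
  have minimize: "\<exists>t. minimal_at n t \<and> (\<forall>i<n. t i = s i)" if "bad s" for s n
  proof -
    define P where "P t \<longleftrightarrow> bad t \<and> (\<forall>i<n. t i = s i)" for t
    have "P s" using that by (simp add: P_def)
    then obtain t where "P t" "\<And>t'. P t' \<Longrightarrow> length (t n) \<le> length (t' n)"
      using ex_has_least_nat[of P s "\<lambda>t. length (t n)"] by blast
    then show ?thesis unfolding P_def minimal_at_def by (intro exI[of _ t]) auto
  qed
  obtain \<phi> :: "nat \<Rightarrow> nat" where "strict_mono \<phi>" "\<forall>i j. i < j \<longrightarrow> C (s (\<phi> i)) (s (\<phi> j))"
    using wqoD[OF C, of s] by blast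
  with not_good have bad_start: "bad (s \<circ> \<phi>)"
    by (auto simp: bad_def strict_mono_less)
  \<comment> \<open>The term \<open>n\<close> of \<open>f n\<close> is as short as its first
    \<open>n\<close> terms allow in a bad sequence, and \<open>f (Suc n)\<close> keeps the terms up
    to \<open>n\<close>. The diagonal is then the minimal bad sequence.\<close>
  have "\<exists>f. \<forall>n. minimal_at n (f n) \<and> (\<forall>i<Suc n. f (Suc n) i = f n i)"
  proof (rule dependent_nat_choice)
    show "\<exists>t. minimal_at 0 t" using minimize[OF bad_start, of 0] by blast
  next
    fix t n assume "minimal_at n t"
    then have "bad t" by (simp add: minimal_at_def)
    then show "\<exists>t'. minimal_at (Suc n) t' \<and> (\<forall>i<Suc n. t' i = t i)" by (rule minimize)
  qed
  then obtain f where f: "\<And>n. minimal_at n (f n)" and f_Suc: "\<And>n i. i \<le> n \<Longrightarrow> f (Suc n) i = f n i"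
    by (auto simp: less_Suc_eq_le)
  define m where "m i = f i i" for i
  have f_eq: "f n i = m i" if "i \<le> n" for n i
    using that by (induction rule: dec_induct) (auto simp: m_def f_Suc)
  have bad_m: "bad m"
    unfolding bad_def
  proof (intro allI impI)
    fix i j :: nat assume "i < j"
    moreover have "bad (f j)" using f by (simp add: minimal_at_def)
    ultimately show "C (m i) (m j) \<and> \<not> R (m i) (m j)" by (metis bad_def f_eq le_refl less_imp_le)
  qed
  have minimal: "length (m k) \<le> length (t k)" if "bad t" "\<And>i. i < k \<Longrightarrow> t i = m i" for t k
    using f[of k] that f_eq unfolding minimal_at_def by (metis le_refl less_imp_le)
  have "m i \<noteq> []" for i
    using bad_m nil unfolding bad_def by (metis lessI)
  moreover define a u where "a i = hd (m i)" and "u i = tl (m i)" for i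
  ultimately have m: "m i = a i # u i" for i by simp
  \<comment> \<open>\<open>C\<close> need not survive removing the head of its first argument, since
    that head may be the letter that was used. So \<open>C\<close> is obtained afresh on the tails,
    together with the order of the heads.\<close>
  obtain \<phi> :: "nat \<Rightarrow> nat" where \<phi>: "strict_mono \<phi>" "\<forall>i j. i < j \<longrightarrow> below (a (\<phi> i)) (a (\<phi> j)) \<and> C (u (\<phi> i)) (u (\<phi> j))"
    using wqoD[OF wqo_conj[OF below C, of fst snd], of "\<lambda>i. (a i, u i)"] unfolding fst_conv snd_conv by blast
  define k where "k = \<phi> 0"
  \<comment> \<open>From position \<open>k\<close> on, terms of \<open>m\<close> are replaced by
    tails. The new term at \<open>k\<close> is shorter than \<open>m k\<close>, so badness of
    \<open>t\<close> contradicts minimality.\<close>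
  define t where "t i = (if i < k then m i else u (\<phi> (i - k)))" for i
  have "bad t"
    unfolding bad_def
  proof (intro allI impI)
    fix i j :: nat assume "i < j"
    consider "j < k" | "i < k" "k \<le> j" | "k \<le> i" by linarith
    then show "C (t i) (t j) \<and> \<not> R (t i) (t j)"
    proof cases
      case 1
      then show ?thesis using bad_m \<open>i < j\<close> by (simp add: t_def bad_def)
    next
      case 2
      have "k \<le> \<phi> (j - k)" using \<phi>(1) by (simp add: k_def strict_mono_less_eq)
      then have "C (m i) (m (\<phi> (j - k)))" "\<not> R (m i) (m (\<phi> (j - k)))"
        using bad_m 2 by (auto simp: bad_def)
      then show ?thesis using 2 C_tl skip by (auto simp: t_def m[of "\<phi> (j - k)"])
    next
      case 3
      have "i - k < j - k" using 3 \<open>i < j\<close> by simp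
      then have "\<phi> (i - k) < \<phi> (j - k)" "below (a (\<phi> (i - k))) (a (\<phi> (j - k)))"
        "C (u (\<phi> (i - k))) (u (\<phi> (j - k)))"
        using \<phi> by (auto simp: strict_mono_less)
      moreover have "\<not> R (m (\<phi> (i - k))) (m (\<phi> (j - k)))"
        using bad_m calculation(1) by (simp add: bad_def)
      ultimately show ?thesis using 3 \<open>i < j\<close> keep by (auto simp: t_def m)
    qed
  qed
  moreover have "t i = m i" if "i < k" for i using that by (simp add: t_def)
  ultimately have "length (m k) \<le> length (t k)" by (rule minimal)
  then show False by (simp add: t_def m k_def)
qed

section \<open>Up-sets of vectors and their decreasing subsequences\<close>

lemma wqo_hoare:
  assumes "wqo below"
  shows "wqo (\<lambda>u v. \<forall>a\<in>set u. \<exists>b\<in>set v. below a b)"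
proof -
  have "wqo (\<lambda>_ _ :: 'a list. True)"
    unfolding wqo_def by (auto intro!: exI[of _ id] simp: strict_mono_id)
  show ?thesis by (rule wqo_lists[OF assms \<open>wqo (\<lambda>_ _. True)\<close>]) auto
qed

text \<open>The complement of an up-set of \<open>\<nat>\<^sup>I\<close> is a finite union of boxes with possibly infinite sides.\<close>

lemma complement_upset_boxes:
  assumes "finite I"
  shows "\<exists>B. \<forall>x::'i \<Rightarrow> nat. (\<exists>a\<in>set u. \<forall>i\<in>I. a i \<le> x i) \<longleftrightarrow> \<not> (\<exists>\<beta>\<in>set B. \<forall>i\<in>I. enat (x i) < \<beta> i)"
proof (induction u)
  case Nil
  show ?case by (rule exI[of _ "[\<lambda>_. \<infinity>]"]) simp
next
  case (Cons a u)
  then obtain B where B: "\<And>x. (\<exists>a\<in>set u. \<forall>i\<in>I. a i \<le> x i) \<longleftrightarrow> \<not> (\<exists>\<beta>\<in>set B. \<forall>i\<in>I. enat (x i) < \<beta> i)"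
    by blast
  obtain ks where ks: "set ks = I" using finite_list[OF assms] by blast
  \<comment> \<open>A vector avoids the up-set of \<open>a\<close> iff \<open>x k < a k\<close> for
    some \<open>k\<close>, so each box is cut along each coordinate in turn.\<close>
  define B' where "B' = [\<beta>(k := min (\<beta> k) (enat (a k))). \<beta> \<leftarrow> B, k \<leftarrow> ks]"
  have "(\<exists>\<beta>\<in>set B'. \<forall>i\<in>I. enat (x i) < \<beta> i) \<longleftrightarrow>
      (\<exists>\<beta>\<in>set B. \<forall>i\<in>I. enat (x i) < \<beta> i) \<and> (\<exists>k\<in>I. x k < a k)" for x
  proof -
    have "(\<forall>i\<in>I. enat (x i) < (\<beta>(k := min (\<beta> k) (enat (a k)))) i) \<longleftrightarrow>
        (\<forall>i\<in>I. enat (x i) < \<beta> i) \<and> x k < a k" if "k \<in> I" for \<beta> k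
      using that by (auto split: if_splits)
    then show ?thesis unfolding B'_def ks[symmetric] by auto
  qed
  then show ?case using B by (intro exI[of _ B']) (auto simp: not_le)
qed

text \<open>Maclagan's theorem on monomial ideals.\<close>

lemma wqo_upset_inclusion:
  assumes "finite I"
  shows "wqo (\<lambda>u v. \<forall>b\<in>set v. \<exists>a\<in>set u. \<forall>i\<in>I. a i \<le> (b i :: nat))"
  unfolding wqo_def
proof
  fix s :: "nat \<Rightarrow> ('a \<Rightarrow> nat) list"
  from choice[OF allI[OF complement_upset_boxes[OF assms]]]
  obtain B where B: "\<forall>u x. (\<exists>a\<in>set u. \<forall>i\<in>I. a i \<le> x i) \<longleftrightarrow> \<not> (\<exists>\<beta>\<in>set (B u). \<forall>i\<in>I. enat (x i) < \<beta> i)" ..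
  \<comment> \<open>Complements reverse inclusion, and a union of boxes grows if each box fits into
    a later one. Since \<open>enat\<close> is well-ordered, boxes are well-quasi-ordered by their
    bounds, and so are finite lists of boxes.\<close>
  obtain \<phi> :: "nat \<Rightarrow> nat" where \<phi>: "strict_mono \<phi>" "\<forall>i j. i < j \<longrightarrow>
      (\<forall>\<beta>\<in>set (B (s (\<phi> i))). \<exists>\<gamma>\<in>set (B (s (\<phi> j))). \<forall>i\<in>I. \<beta> i \<le> \<gamma> i)"
    using wqoD[OF wqo_hoare[OF wqo_pointwise[OF assms]], of "\<lambda>i. B (s i)"] by blast
  have "\<exists>a\<in>set (s (\<phi> i)). \<forall>i\<in>I. a i \<le> b i" if ij: "i < j" and b: "b \<in> set (s (\<phi> j))" for i j b
  proof (rule ccontr)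
    assume "\<not> ?thesis"
    then obtain \<beta> where "\<beta> \<in> set (B (s (\<phi> i)))" "\<forall>i\<in>I. enat (b i) < \<beta> i" using B by blast
    then obtain \<gamma> where "\<gamma> \<in> set (B (s (\<phi> j)))" "\<forall>i\<in>I. enat (b i) < \<gamma> i"
      using \<phi>(2) ij by (meson less_le_trans)
    then have "\<not> (\<exists>a\<in>set (s (\<phi> j)). \<forall>i\<in>I. a i \<le> b i)" using B by blast
    then show False using b by blast
  qed
  with \<phi>(1) show "\<exists>\<phi>::nat \<Rightarrow> nat. strict_mono \<phi> \<and>
      (\<forall>i j. i < j \<longrightarrow> (\<forall>b\<in>set (s (\<phi> j)). \<exists>a\<in>set (s (\<phi> i)). \<forall>i\<in>I. a i \<le> b i))"
    by (intro exI[of _ \<phi>]) simp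
qed

text \<open>In \<open>skip\<close> the letter \<open>a\<close> comes from the current
  \<open>u\<close>, the suffix still to be matched, and not from the whole first word. A removed
  letter is thus sent to a letter matched later in \<open>v\<close>; this makes the induced
  surjection compatible with the lexicographic order.\<close>

inductive surj_emb :: "('a \<Rightarrow> 'a \<Rightarrow> bool) \<Rightarrow> 'a list \<Rightarrow> 'a list \<Rightarrow> bool" for below where
  nil: "surj_emb below [] []"
| keep: "below a b \<Longrightarrow> surj_emb below u v \<Longrightarrow> surj_emb below (a # u) (b # v)"
| skip: "a \<in> set u \<Longrightarrow> below a b \<Longrightarrow> surj_emb below u v \<Longrightarrow> surj_emb below u (b # v)"

text \<open>The side condition is inclusion of the generated up-sets: it supplies the letter that
  \<open>skip\<close> demands, and it allows only the empty word after an empty word.\<close>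

lemma wqo_surj_emb:
  assumes "finite I"
  shows "wqo (surj_emb (\<lambda>a b :: 'i \<Rightarrow> nat. \<forall>i\<in>I. a i \<le> b i))"
proof (rule wqo_lists[OF wqo_pointwise[OF assms] wqo_upset_inclusion[OF assms]])
  fix v :: "('i \<Rightarrow> nat) list"
  assume "\<forall>b\<in>set v. \<exists>a\<in>set []. \<forall>i\<in>I. a i \<le> b i"
  then show "surj_emb (\<lambda>a b. \<forall>i\<in>I. a i \<le> b i) [] v" by (cases v) (auto intro: surj_emb.nil)
qed (auto intro: surj_emb.intros)


section \<open>Quotients of contravariant functors\<close>

lemma ring_extend_simps [simp]:
  "carrier (ring.extend R m) = carrier R"
  "monoid.mult (ring.extend R m) = monoid.mult R"
  "monoid.one (ring.extend R m) = monoid.one R"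
  "ring.zero (ring.extend R m) = ring.zero R"
  "add (ring.extend R m) = add R"
  by (simp_all add: ring.defs)

lemma cring_extend:
  assumes "cring R"
  shows "cring (ring.extend R m)"
proof -
  interpret cring R by fact
  show ?thesis
  proof (rule cringI)
    show "abelian_group (ring.extend R m)"
      by (rule abelian_groupI) (auto simp: add.m_ac intro: add.l_inv_ex)
    show "comm_monoid (ring.extend R m)"
      by (rule comm_monoidI) (auto simp: m_ac)
  qed (simp add: l_distr)
qed

text \<open>Serves both for pullbacks and for multiplication by a scalar; the latter is additive but
  not a ring homomorphism.\<close>

lemma UN_coset_hom:
  assumes "ideal I R" "ideal J Q"
    and f: "f \<in> carrier R \<rightarrow> carrier Q"
    and f_add: "\<And>x y. x \<in> carrier R \<Longrightarrow> y \<in> carrier R \<Longrightarrow> f (x \<oplus>\<^bsub>R\<^esub> y) = f x \<oplus>\<^bsub>Q\<^esub> f y"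
    and f_ideal: "f ` I \<subseteq> J" and b: "b \<in> carrier R"
  shows "(\<Union>b'\<in>I +>\<^bsub>R\<^esub> b. J +>\<^bsub>Q\<^esub> f b') = J +>\<^bsub>Q\<^esub> f b"
proof -
  interpret I: ideal I R by fact
  interpret J: ideal J Q by fact
  have "J +>\<^bsub>Q\<^esub> f b' = J +>\<^bsub>Q\<^esub> f b" if "b' \<in> I +>\<^bsub>R\<^esub> b" for b'
  proof -
    obtain i where i: "i \<in> I" "b' = i \<oplus>\<^bsub>R\<^esub> b"
      using \<open>b' \<in> I +>\<^bsub>R\<^esub> b\<close> by (auto simp: a_r_coset_def')
    then have "f b' = f i \<oplus>\<^bsub>Q\<^esub> f b" using f_add b I.a_Hcarr by simp
    moreover have "f i \<in> J" using f_ideal i by blast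
    ultimately have "f b' \<in> J +>\<^bsub>Q\<^esub> f b" by (auto simp: a_r_coset_def')
    then show ?thesis using J.a_repr_independence' f b by blast
  qed
  moreover have "b \<in> I +>\<^bsub>R\<^esub> b" using b by (rule I.a_rcos_self)
  ultimately show ?thesis by blast
qed

locale fin_op_algebra_with_ideal = fin_op_algebra K B pull
  for K :: "('k, 'm) ring_scheme" and B :: "'s set \<Rightarrow> ('k, 'b) module" and pull +
  fixes I :: "'s set \<Rightarrow> 'b set"
  assumes fin_op_ideal: "fin_op_ideal B pull I"
begin

lemma ideal: "finite S \<Longrightarrow> ideal (I S) (B S)"
  using fin_op_ideal by (simp add: fin_op_ideal_def)

lemma B_cring: "finite S \<Longrightarrow> cring (B S)"
  using algebra algebra.M_cring by blast

lemma pull_closed: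
  "\<lbrakk>finite S; finite T; \<pi> \<in> S \<rightarrow>\<^sub>E T; b \<in> carrier (B T)\<rbrakk> \<Longrightarrow> pull S T \<pi> b \<in> carrier (B S)"
  using pull_hom by (rule ring_hom_closed)

lemma quot_carrier: "carrier (fin_op_quot B I S) = (\<lambda>b. I S +>\<^bsub>B S\<^esub> b) ` carrier (B S)"
  by (auto simp: fin_op_quot_def FactRing_simps)

lemma quot_add:
  "\<lbrakk>finite S; a \<in> carrier (B S); b \<in> carrier (B S)\<rbrakk> \<Longrightarrow>
    (I S +>\<^bsub>B S\<^esub> a) \<oplus>\<^bsub>fin_op_quot B I S\<^esub> (I S +>\<^bsub>B S\<^esub> b) = I S +>\<^bsub>B S\<^esub> (a \<oplus>\<^bsub>B S\<^esub> b)"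
  by (simp add: fin_op_quot_def FactRing_def ideal.a_rcos_sum[OF ideal])

lemma quot_mult:
  "\<lbrakk>finite S; a \<in> carrier (B S); b \<in> carrier (B S)\<rbrakk> \<Longrightarrow>
    (I S +>\<^bsub>B S\<^esub> a) \<otimes>\<^bsub>fin_op_quot B I S\<^esub> (I S +>\<^bsub>B S\<^esub> b) = I S +>\<^bsub>B S\<^esub> (a \<otimes>\<^bsub>B S\<^esub> b)"
  by (simp add: fin_op_quot_def FactRing_def ideal.rcoset_mult_add[OF ideal])

lemma quot_one: "\<one>\<^bsub>fin_op_quot B I S\<^esub> = I S +>\<^bsub>B S\<^esub> \<one>\<^bsub>B S\<^esub>"
  by (simp add: fin_op_quot_def FactRing_def)

lemma quot_cring: "finite S \<Longrightarrow> cring (fin_op_quot B I S)"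
  unfolding fin_op_quot_def
  by (intro cring_extend ideal.quotient_is_cring ideal B_cring)

lemma quot_smult:
  assumes "finite S" "c \<in> carrier K" "b \<in> carrier (B S)"
  shows "c \<odot>\<^bsub>fin_op_quot B I S\<^esub> (I S +>\<^bsub>B S\<^esub> b) = I S +>\<^bsub>B S\<^esub> (c \<odot>\<^bsub>B S\<^esub> b)"
proof -
  interpret algebra K "B S" using assms by (simp add: algebra)
  interpret ideal "I S" "B S" using assms by (simp add: ideal)
  have "c \<odot>\<^bsub>B S\<^esub> i \<in> I S" if "i \<in> I S" for i
  proof -
    have "i \<in> carrier (B S)" using that by (rule a_Hcarr)
    then have "c \<odot>\<^bsub>B S\<^esub> i = (c \<odot>\<^bsub>B S\<^esub> \<one>\<^bsub>B S\<^esub>) \<otimes>\<^bsub>B S\<^esub> i"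
      using assms by (simp add: smult_assoc2)
    then show ?thesis using that assms by (simp add: I_l_closed)
  qed
  then show ?thesis
    unfolding fin_op_quot_def using assms
    by (simp add: module.defs ring.defs) (rule UN_coset_hom[OF ideal_axioms ideal_axioms], auto simp: smult_r_distr)
qed

lemma quot_pull_coset:
  assumes "finite S" "finite T" "\<pi> \<in> S \<rightarrow>\<^sub>E T" "b \<in> carrier (B T)"
  shows "quot_pull B pull I S T \<pi> (I T +>\<^bsub>B T\<^esub> b) = I S +>\<^bsub>B S\<^esub> pull S T \<pi> b"
  unfolding quot_pull_def
proof (rule UN_coset_hom)
  show "pull S T \<pi> ` I T \<subseteq> I S" using fin_op_ideal assms by (auto simp: fin_op_ideal_def)
qed (use assms in \<open>auto simp: ideal pull_closed ring_hom_add[OF pull_hom]\<close>)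

lemma quot_algebra:
  assumes "finite S"
  shows "algebra K (fin_op_quot B I S)"
proof -
  interpret algebra K "B S" using assms by (simp add: algebra)
  show ?thesis
    by (rule algebraI)
      (use assms in \<open>auto simp: R_cring quot_cring quot_carrier quot_smult quot_add quot_mult
         smult_l_distr smult_r_distr smult_assoc1 smult_assoc2\<close>)
qed

lemma quot_fin_op_algebra: "fin_op_algebra K (fin_op_quot B I) (quot_pull B pull I)"
proof (rule fin_op_algebra.intro)
  fix S :: "'s set" assume "finite S"
  then show "algebra K (fin_op_quot B I S)" by (rule quot_algebra)
next
  fix S T :: "'s set" and \<pi> assume *: "finite S" "finite T" "\<pi> \<in> S \<rightarrow>\<^sub>E T"
  interpret S: cring "B S" using * by (simp add: B_cring)
  interpret T: cring "B T" using * by (simp add: B_cring)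
  show "quot_pull B pull I S T \<pi> \<in> ring_hom (fin_op_quot B I T) (fin_op_quot B I S)"
    by (rule ring_hom_memI)
      (use * in \<open>auto simp: quot_carrier quot_pull_coset pull_closed quot_add quot_mult quot_one
        ring_hom_add[OF pull_hom] ring_hom_mult[OF pull_hom] ring_hom_one[OF pull_hom]\<close>)
next
  fix S T :: "'s set" and \<pi> c C
  assume *: "finite S" "finite T" "\<pi> \<in> S \<rightarrow>\<^sub>E T" "c \<in> carrier K" "C \<in> carrier (fin_op_quot B I T)"
  interpret algebra K "B T" using * by (simp add: algebra)
  show "quot_pull B pull I S T \<pi> (c \<odot>\<^bsub>fin_op_quot B I T\<^esub> C) = c \<odot>\<^bsub>fin_op_quot B I S\<^esub> quot_pull B pull I S T \<pi> C"
    using * by (auto simp: quot_carrier quot_pull_coset quot_smult pull_closed pull_smult)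
next
  fix S :: "'s set" and C assume "finite S" "C \<in> carrier (fin_op_quot B I S)"
  then show "quot_pull B pull I S S (\<lambda>s\<in>S. s) C = C"
    by (auto simp: quot_carrier quot_pull_coset pull_id)
next
  fix S T U :: "'s set" and \<pi> \<rho> C
  assume *: "finite S" "finite T" "finite U" "\<pi> \<in> S \<rightarrow>\<^sub>E T" "\<rho> \<in> T \<rightarrow>\<^sub>E U" "C \<in> carrier (fin_op_quot B I U)"
  have "compose S \<rho> \<pi> \<in> S \<rightarrow>\<^sub>E U" using * by (auto simp: compose_def)
  then show "quot_pull B pull I S U (compose S \<rho> \<pi>) C =
      quot_pull B pull I S T \<pi> (quot_pull B pull I T U \<rho> C)"
    using * by (auto simp: quot_carrier quot_pull_coset pull_compose pull_closed)
qed

lemma coset_zero: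
  assumes "finite S" "b \<in> I S"
  shows "I S +>\<^bsub>B S\<^esub> b = \<zero>\<^bsub>fin_op_quot B I S\<^esub>"
proof -
  interpret cring "B S" using assms(1) by (rule B_cring)
  show ?thesis
    using a_rcos_zero[OF ideal[OF assms(1)] assms(2)] by (simp add: fin_op_quot_def FactRing_def)
qed

lemma coset_ring_hom:
  assumes "finite S"
  shows "ring_hom_ring (B S) (fin_op_quot B I S) (\<lambda>b. I S +>\<^bsub>B S\<^esub> b)"
proof -
  interpret cring "B S" using assms by (rule B_cring)
  interpret Q: cring "fin_op_quot B I S" using assms by (rule quot_cring)
  show ?thesis
    by (rule ring_hom_ringI)
      (use assms in \<open>auto simp: ring_axioms Q.ring_axioms quot_carrier quot_add quot_mult quot_one\<close>)
qed

text \<open>The assumption expresses generation modulo \<open>I\<close> inside \<open>B\<close>, by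
  a universal property over ideals \<open>H\<close>. An ideal of the quotient is replaced by its
  preimage \<open>J\<close>; for \<open>H\<close> one takes the preimage of the ideal that the
  cosets of the generators generate.\<close>

lemma quot_noetherian:
  assumes gen: "\<And>J. \<lbrakk>fin_op_ideal B pull J; \<forall>S. finite S \<longrightarrow> I S \<subseteq> J S\<rbrakk> \<Longrightarrow>
    \<exists>G. finite G \<and> (\<forall>(T, b)\<in>G. finite T \<and> b \<in> J T) \<and>
      (\<forall>S H. finite S \<longrightarrow> ideal H (B S) \<longrightarrow> I S \<subseteq> H \<longrightarrow>
        {pull S T \<pi> b |T b \<pi>. (T, b) \<in> G \<and> \<pi> \<in> S \<rightarrow>\<^sub>E T} \<subseteq> H \<longrightarrow> J S \<subseteq> H)"
  shows "noetherian_fin_op_algebra K (fin_op_quot B I) (quot_pull B pull I)"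
proof (intro noetherian_fin_op_algebra.intro quot_fin_op_algebra noetherian_fin_op_algebra_axioms.intro)
  fix J' assume J': "fin_op_ideal (fin_op_quot B I) (quot_pull B pull I) J'"
  have J'_ideal: "ideal (J' S) (fin_op_quot B I S)" if "finite S" for S
    using J' that by (simp add: fin_op_ideal_def)
  have J'_pull: "quot_pull B pull I S T \<pi> C \<in> J' S"
    if "finite S" "finite T" "\<pi> \<in> S \<rightarrow>\<^sub>E T" "C \<in> J' T" for S T \<pi> C
    using J' that unfolding fin_op_ideal_def by blast
  define J where "J S = {b \<in> carrier (B S). I S +>\<^bsub>B S\<^esub> b \<in> J' S}" for S
  have J_ideal: "ideal (J S) (B S)" if "finite S" for S
    unfolding J_def using ring_hom_ring.ideal_vimage[OF coset_ring_hom[OF that] J'_ideal[OF that]] .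
  have I_J: "I S \<subseteq> J S" if "finite S" for S
  proof
    fix b assume b: "b \<in> I S"
    interpret ideal "I S" "B S" using that by (rule ideal)
    interpret J': ideal "J' S" "fin_op_quot B I S" using that by (rule J'_ideal)
    show "b \<in> J S" using b coset_zero[OF that b] J'.zero_closed a_Hcarr by (simp add: J_def)
  qed
  have "fin_op_ideal B pull J"
    unfolding fin_op_ideal_def
  proof (intro conjI allI impI ballI)
    fix S T :: "'s set" and \<pi> assume *: "finite S" "finite T" "\<pi> \<in> S \<rightarrow>\<^sub>E T"
    show "pull S T \<pi> ` J T \<subseteq> J S"
      using * J'_pull[OF *] by (auto simp: J_def pull_closed quot_pull_coset[symmetric])
  qed (rule J_ideal)
  moreover have "\<forall>S. finite S \<longrightarrow> I S \<subseteq> J S" using I_J by blast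
  ultimately have "\<exists>G. finite G \<and> (\<forall>(T, b)\<in>G. finite T \<and> b \<in> J T) \<and>
      (\<forall>S H. finite S \<longrightarrow> ideal H (B S) \<longrightarrow> I S \<subseteq> H \<longrightarrow>
        {pull S T \<pi> b |T b \<pi>. (T, b) \<in> G \<and> \<pi> \<in> S \<rightarrow>\<^sub>E T} \<subseteq> H \<longrightarrow> J S \<subseteq> H)"
    by (rule gen)
  then obtain G where G: "finite G" "\<forall>(T, b)\<in>G. finite T \<and> b \<in> J T"
    and G_gen: "\<forall>S H. finite S \<longrightarrow> ideal H (B S) \<longrightarrow> I S \<subseteq> H \<longrightarrow>
        {pull S T \<pi> b |T b \<pi>. (T, b) \<in> G \<and> \<pi> \<in> S \<rightarrow>\<^sub>E T} \<subseteq> H \<longrightarrow> J S \<subseteq> H"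
    by (elim exE conjE) (rule that)
  define G' where "G' = (\<lambda>(T, b). (T, I T +>\<^bsub>B T\<^esub> b)) ` G"
  show "\<exists>G'. finite G' \<and> (\<forall>(T, C)\<in>G'. finite T \<and> C \<in> carrier (fin_op_quot B I T)) \<and>
      (\<forall>S. finite S \<longrightarrow> J' S = fin_op_genideal (fin_op_quot B I) (quot_pull B pull I) G' S)"
  proof (intro exI[of _ G'] conjI allI impI)
    show "finite G'" using G by (simp add: G'_def)
    show "\<forall>(T, C)\<in>G'. finite T \<and> C \<in> carrier (fin_op_quot B I T)"
      using G(2) by (force simp: G'_def J_def quot_carrier)
  next
    fix S :: "'s set" assume S: "finite S"
    interpret Q: cring "fin_op_quot B I S" using S by (rule quot_cring)
    define gens where "gens = {quot_pull B pull I S T \<pi> c |T c \<pi>. (T, c) \<in> G' \<and> \<pi> \<in> S \<rightarrow>\<^sub>E T}"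
    have gens_J': "gens \<subseteq> J' S"
      using G(2) J'_pull[OF S] by (auto simp: gens_def G'_def J_def)
    have J'_carrier: "J' S \<subseteq> carrier (fin_op_quot B I S)"
      using ideal.Icarr[OF J'_ideal[OF S]] by blast
    define L where "L = Idl\<^bsub>fin_op_quot B I S\<^esub> gens"
    define H where "H = {b \<in> carrier (B S). I S +>\<^bsub>B S\<^esub> b \<in> L}"
    have Idl: "ideal L (fin_op_quot B I S)"
      unfolding L_def using gens_J' J'_carrier by (intro Q.genideal_ideal) blast
    have "J S \<subseteq> H"
    proof (rule G_gen[rule_format, OF S])
      show "ideal H (B S)"
        unfolding H_def by (rule ring_hom_ring.ideal_vimage[OF coset_ring_hom[OF S] Idl])
      show "I S \<subseteq> H"
      proof
        fix b assume b: "b \<in> I S"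
        interpret ideal "I S" "B S" using S by (rule ideal)
        show "b \<in> H"
          using b coset_zero[OF S b] a_Hcarr additive_subgroup.zero_closed[OF ideal.axioms(1)[OF Idl]] by (simp add: H_def)
      qed
      show "{pull S T \<pi> b |T b \<pi>. (T, b) \<in> G \<and> \<pi> \<in> S \<rightarrow>\<^sub>E T} \<subseteq> H"
      proof clarify
        fix T b \<pi> assume *: "(T, b) \<in> G" "\<pi> \<in> S \<rightarrow>\<^sub>E T"
        then have T: "finite T" "b \<in> carrier (B T)" using G(2) by (auto simp: J_def)
        have "I S +>\<^bsub>B S\<^esub> pull S T \<pi> b \<in> gens"
          unfolding gens_def G'_def using * T S quot_pull_coset[OF S T(1) *(2) T(2)] by force
        then have "I S +>\<^bsub>B S\<^esub> pull S T \<pi> b \<in> L"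
          using Q.genideal_self[of gens] gens_J' J'_carrier unfolding L_def by blast
        then show "pull S T \<pi> b \<in> H" using * T S by (simp add: H_def pull_closed)
      qed
    qed
    have "J' S \<subseteq> L"
    proof
      fix C assume C: "C \<in> J' S"
      then obtain b where b: "b \<in> carrier (B S)" "C = I S +>\<^bsub>B S\<^esub> b"
        using J'_carrier by (auto simp: quot_carrier)
      then have "b \<in> J S" using C by (simp add: J_def)
      then show "C \<in> L" using \<open>J S \<subseteq> H\<close> b by (auto simp: H_def)
    qed
    moreover have "L \<subseteq> J' S"
      unfolding L_def using J'_ideal[OF S] gens_J' by (rule Q.genideal_minimal)
    ultimately show "J' S = fin_op_genideal (fin_op_quot B I) (quot_pull B pull I) G' S"
      by (simp add: fin_op_genideal_def gens_def L_def)
  qed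
qed

end


section \<open>Polynomial algebras of tensors\<close>

text \<open>Pushforward of finitely supported functions. It occurs on exponents, where it renames
  variables; on polynomials, where it maps monomials; and as the passage from polynomials to the
  monoid algebra of profiles.\<close>

definition push_keys :: "('a \<Rightarrow> 'b) \<Rightarrow> ('a \<Rightarrow>\<^sub>0 'c::comm_monoid_add) \<Rightarrow> 'b \<Rightarrow>\<^sub>0 'c"
  where "push_keys f p = (\<Sum>m\<in>Poly_Mapping.keys p. Poly_Mapping.single (f m) (Poly_Mapping.lookup p m))"

lemma push_keys_superset:
  assumes "finite A" "Poly_Mapping.keys p \<subseteq> A"
  shows "push_keys f p = (\<Sum>m\<in>A. Poly_Mapping.single (f m) (Poly_Mapping.lookup p m))"
  unfolding push_keys_def using assms by (intro sum.mono_neutral_left) (auto simp: in_keys_iff)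

lemma push_keys_zero [simp]: "push_keys f 0 = 0"
  by (simp add: push_keys_def)

lemma push_keys_single [simp]: "push_keys f (Poly_Mapping.single m c) = Poly_Mapping.single (f m) c"
  by (subst push_keys_superset[of "{m}"]) auto

lemma push_keys_add: "push_keys f (p + q) = push_keys f p + push_keys f q"
proof -
  let ?A = "Poly_Mapping.keys p \<union> Poly_Mapping.keys q"
  have "push_keys f r = (\<Sum>m\<in>?A. Poly_Mapping.single (f m) (Poly_Mapping.lookup r m))"
    if "Poly_Mapping.keys r \<subseteq> ?A" for r
    using that by (intro push_keys_superset) auto
  note * = this
  show ?thesis
    using *[of "p + q"] *[of p] *[of q] Poly_Mapping.keys_add[of p q]
    by (simp add: lookup_add single_add sum.distrib)
qed

lemma push_keys_diff:
  fixes p q :: "'a \<Rightarrow>\<^sub>0 'c::ab_group_add"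
  shows "push_keys f (p - q) = push_keys f p - push_keys f q"
  using push_keys_add[of f "p - q" q] by (simp add: algebra_simps)

lemma push_keys_sum: "push_keys f (sum p A) = (\<Sum>a\<in>A. push_keys f (p a))"
  by (induction A rule: infinite_finite_induct) (simp_all add: push_keys_add)

lemma sum_singles: "(\<Sum>m\<in>Poly_Mapping.keys p. Poly_Mapping.single m (Poly_Mapping.lookup p m)) = p"
proof (rule poly_mapping_eqI)
  fix k
  show "Poly_Mapping.lookup (\<Sum>m\<in>Poly_Mapping.keys p. Poly_Mapping.single m (Poly_Mapping.lookup p m)) k
    = Poly_Mapping.lookup p k"
    by (simp add: lookup_sum lookup_single when_def sum.delta in_keys_iff)
qed

lemma push_keys_id [simp]: "push_keys (\<lambda>m. m) p = p"
  by (simp add: push_keys_def sum_singles)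

lemma push_keys_cong: "(\<And>m. m \<in> Poly_Mapping.keys p \<Longrightarrow> f m = g m) \<Longrightarrow> push_keys f p = push_keys g p"
  by (simp add: push_keys_def)

lemma push_keys_push_keys: "push_keys f (push_keys g p) = push_keys (\<lambda>m. f (g m)) p"
  by (simp add: push_keys_def[of g] push_keys_def[of "\<lambda>m. f (g m)"] push_keys_sum)

lemma keys_push_keys: "Poly_Mapping.keys (push_keys f p) \<subseteq> f ` Poly_Mapping.keys p"
  unfolding push_keys_def by (rule order_trans[OF keys_sum]) (auto split: if_splits)

lemma push_keys_mult:
  fixes p q :: "'a::monoid_add \<Rightarrow>\<^sub>0 'c::semiring_0"
  assumes "\<And>m m'. f (m + m') = f m + f m'"
  shows "push_keys f (p * q) = push_keys f p * push_keys f q"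
proof -
  have "push_keys f (p * q) = push_keys f
      ((\<Sum>m\<in>Poly_Mapping.keys p. Poly_Mapping.single m (Poly_Mapping.lookup p m)) *
       (\<Sum>m\<in>Poly_Mapping.keys q. Poly_Mapping.single m (Poly_Mapping.lookup q m)))"
    by (simp only: sum_singles)
  also have "\<dots> = push_keys f p * push_keys f q"
    unfolding sum_product mult_single push_keys_sum push_keys_single assms
    by (simp add: push_keys_def sum_product mult_single)
  finally show ?thesis .
qed

lemma const_mpoly_single: "const_mpoly c * Poly_Mapping.single m d = Poly_Mapping.single m (c * d)"
  by (simp add: const_mpoly_def mult_single)

lemma var_mpoly_power: "var_mpoly v ^ k = Poly_Mapping.single (Poly_Mapping.single v k) 1"
  by (induction k) (simp_all add: var_mpoly_def mult_single flip: single_add)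

lemma prod_monomials:
  "(\<Prod>a\<in>A. Poly_Mapping.single (m a) (1::'k::field)) = Poly_Mapping.single (\<Sum>a\<in>A. m a) 1"
  for m :: "'b \<Rightarrow> 'v \<Rightarrow>\<^sub>0 nat"
  by (induction A rule: infinite_finite_induct) (simp_all add: mult_single)

lemma subst_mpoly_var: "subst_mpoly (\<lambda>v. var_mpoly (f v)) p = push_keys (push_keys f) p"
  by (simp add: subst_mpoly_def var_mpoly_power prod_monomials const_mpoly_single push_keys_def)

lemma tensor_pull_eq: "tensor_pull S T \<pi> p = push_keys (push_keys (\<lambda>\<alpha>. compose S \<alpha> \<pi>)) p"
  by (simp add: tensor_pull_def subst_mpoly_var)

section \<open>The polynomial algebras and their pullbacks as a contravariant functor\<close>

definition monomials :: "'v set \<Rightarrow> ('v \<Rightarrow>\<^sub>0 nat) set"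
  where "monomials V = {m. Poly_Mapping.keys m \<subseteq> V}"

lemma monomials_zero [simp]: "0 \<in> monomials V"
  by (simp add: monomials_def)

lemma monomials_add: "m \<in> monomials V \<Longrightarrow> m' \<in> monomials V \<Longrightarrow> m + m' \<in> monomials V"
  using Poly_Mapping.keys_add[of m m'] by (auto simp: monomials_def)

lemma monomials_addD: "m + m' \<in> monomials V \<Longrightarrow> m \<in> monomials V \<and> m' \<in> monomials V"
  for m m' :: "'v \<Rightarrow>\<^sub>0 nat"
  by (auto simp: monomials_def in_keys_iff lookup_add subset_iff)

lemma monomials_single: "v \<in> V \<Longrightarrow> Poly_Mapping.single v k \<in> monomials V"
  by (simp add: monomials_def)

lemma monomials_push_keys: "m \<in> monomials V \<Longrightarrow> (\<And>v. v \<in> V \<Longrightarrow> f v \<in> W) \<Longrightarrow> push_keys f m \<in> monomials W"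
  using keys_push_keys[of f m] by (force simp: monomials_def)

lemma mpoly_algebra_simps [simp]:
  "p \<in> carrier (mpoly_algebra V) \<longleftrightarrow> Poly_Mapping.keys p \<subseteq> monomials V"
  "p \<oplus>\<^bsub>mpoly_algebra V\<^esub> q = p + q"
  "p \<otimes>\<^bsub>mpoly_algebra V\<^esub> q = p * q"
  "\<zero>\<^bsub>mpoly_algebra V\<^esub> = 0"
  "\<one>\<^bsub>mpoly_algebra V\<^esub> = 1"
  "c \<odot>\<^bsub>mpoly_algebra V\<^esub> p = const_mpoly c * p"
  by (auto simp: mpoly_algebra_def monomials_def)

lemma mpoly_mult_closed:
  "Poly_Mapping.keys p \<subseteq> monomials V \<Longrightarrow> Poly_Mapping.keys q \<subseteq> monomials V \<Longrightarrow> Poly_Mapping.keys (p * q) \<subseteq> monomials V"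
  using keys_mult[of p q] by (force intro: monomials_add)

lemma mpoly_add_closed:
  "Poly_Mapping.keys p \<subseteq> monomials V \<Longrightarrow> Poly_Mapping.keys q \<subseteq> monomials V \<Longrightarrow> Poly_Mapping.keys (p + q) \<subseteq> monomials V"
  using Poly_Mapping.keys_add[of p q] by force

lemma keys_uminus: "Poly_Mapping.keys (- p) = Poly_Mapping.keys (p :: 'a \<Rightarrow>\<^sub>0 'b::ab_group_add)"
  by (auto simp: in_keys_iff)

lemma const_mpoly_closed: "Poly_Mapping.keys (const_mpoly c) \<subseteq> monomials V"
  by (simp add: const_mpoly_def)

lemma mpoly_algebra_cring: "cring (mpoly_algebra V :: ('k::field, ('v, 'k) mpoly) module)"
proof (rule cringI)
  show "abelian_group (mpoly_algebra V :: ('k, ('v, 'k) mpoly) module)"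
  proof (rule abelian_groupI)
    fix p :: "('v, 'k) mpoly" assume "p \<in> carrier (mpoly_algebra V)"
    then show "\<exists>q\<in>carrier (mpoly_algebra V). q \<oplus>\<^bsub>mpoly_algebra V\<^esub> p = \<zero>\<^bsub>mpoly_algebra V\<^esub>"
      by (intro bexI[of _ "- p"]) (simp_all add: keys_uminus)
  qed (simp_all add: mpoly_add_closed algebra_simps)
  show "comm_monoid (mpoly_algebra V :: ('k, ('v, 'k) mpoly) module)"
    by (rule comm_monoidI) (simp_all add: mpoly_mult_closed algebra_simps)
qed (simp add: algebra_simps)

lemma const_mpoly_hom:
  "const_mpoly (c + d) = const_mpoly c + const_mpoly d"
  "const_mpoly (c * d) = const_mpoly c * const_mpoly d"
  "const_mpoly 1 = 1"
  by (simp_all add: const_mpoly_def single_add mult_single)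

lemma mpoly_algebra_algebra:
  "algebra (ring_of_type_algebra :: 'k::field ring) (mpoly_algebra V :: ('k, ('v, 'k) mpoly) module)"
proof (rule algebraI)
  show "cring (ring_of_type_algebra :: 'k ring)" by (rule cring_from_type_algebra)
qed (simp_all add: mpoly_algebra_cring mpoly_mult_closed const_mpoly_closed
      ring_of_type_algebra_def const_mpoly_hom algebra_simps)

lemma tensor_pull_hom:
  assumes "\<pi> \<in> S \<rightarrow>\<^sub>E T"
  shows "tensor_pull S T \<pi> \<in> ring_hom (tensor_algebra n T) (tensor_algebra n S)"
proof (rule ring_hom_memI)
  have comp: "compose S \<alpha> \<pi> \<in> S \<rightarrow>\<^sub>E {1..n}" if "\<alpha> \<in> T \<rightarrow>\<^sub>E {1..n}" for \<alpha>
    using assms that by (auto simp: compose_def)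
  fix p :: "('a \<Rightarrow> nat, 'b) mpoly" assume "p \<in> carrier (tensor_algebra n T)"
  then show "tensor_pull S T \<pi> p \<in> carrier (tensor_algebra n S)"
    using keys_push_keys[of "push_keys (\<lambda>\<alpha>. compose S \<alpha> \<pi>)" p] monomials_push_keys[OF _ comp]
    by (fastforce simp: tensor_algebra_def tensor_pull_eq)
qed (simp_all add: tensor_algebra_def tensor_pull_eq push_keys_add push_keys_mult flip: single_one)

lemma tensor_fin_op_algebra:
  "fin_op_algebra (ring_of_type_algebra :: 'k::field ring)
    (tensor_algebra n :: 's set \<Rightarrow> ('k, ('s \<Rightarrow> nat, 'k) mpoly) module) tensor_pull"
proof (rule fin_op_algebra.intro)
  fix S :: "'s set"
  show "algebra (ring_of_type_algebra :: 'k ring) (tensor_algebra n S :: ('k, ('s \<Rightarrow> nat, 'k) mpoly) module)"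
    by (simp add: tensor_algebra_def mpoly_algebra_algebra)
next
  fix S T :: "'s set" and \<pi> assume "\<pi> \<in> S \<rightarrow>\<^sub>E T"
  then show "tensor_pull S T \<pi> \<in> ring_hom (tensor_algebra n T :: ('k, ('s \<Rightarrow> nat, 'k) mpoly) module) (tensor_algebra n S)"
    by (rule tensor_pull_hom)
next
  fix S T :: "'s set" and \<pi> and c :: 'k and p :: "('s \<Rightarrow> nat, 'k) mpoly"
  show "tensor_pull S T \<pi> (c \<odot>\<^bsub>tensor_algebra n T\<^esub> p) = c \<odot>\<^bsub>tensor_algebra n S\<^esub> tensor_pull S T \<pi> p"
    by (simp add: tensor_algebra_def tensor_pull_eq push_keys_mult push_keys_add const_mpoly_def)
next
  fix S :: "'s set" and p :: "('s \<Rightarrow> nat, 'k) mpoly"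
  assume p: "p \<in> carrier (tensor_algebra n S)"
  have "compose S \<alpha> (\<lambda>s\<in>S. s) = \<alpha>" if "\<alpha> \<in> S \<rightarrow>\<^sub>E {1..n}" for \<alpha> :: "'s \<Rightarrow> nat"
    using that by (auto simp: compose_def PiE_def extensional_def)
  then have "push_keys (\<lambda>\<alpha>. compose S \<alpha> (\<lambda>s\<in>S. s)) m = m" if "m \<in> monomials (S \<rightarrow>\<^sub>E {1..n})" for m :: "('s \<Rightarrow> nat) \<Rightarrow>\<^sub>0 nat"
    using that push_keys_cong[of m "\<lambda>\<alpha>. compose S \<alpha> (\<lambda>s\<in>S. s)" "\<lambda>\<alpha>. \<alpha>"] by (force simp: monomials_def)
  then show "tensor_pull S S (\<lambda>s\<in>S. s) p = p"
    using p push_keys_cong[of p "push_keys (\<lambda>\<alpha>. compose S \<alpha> (\<lambda>s\<in>S. s))" "\<lambda>m. m"]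
    by (force simp: tensor_algebra_def tensor_pull_eq)
next
  fix S T U :: "'s set" and \<pi> \<rho> and p :: "('s \<Rightarrow> nat, 'k) mpoly"
  assume "\<pi> \<in> S \<rightarrow>\<^sub>E T"
  then have "compose S \<alpha> (compose S \<rho> \<pi>) = compose S (compose T \<alpha> \<rho>) \<pi>" for \<alpha> :: "'s \<Rightarrow> nat"
    by (auto simp: compose_def fun_eq_iff restrict_def)
  then show "tensor_pull S U (compose S \<rho> \<pi>) p = tensor_pull S T \<pi> (tensor_pull T U \<rho> p)"
    by (simp add: tensor_pull_eq push_keys_push_keys)
qed


section \<open>Profiles and the ideal of rank-one tensors\<close>

lemma single_split:
  fixes m :: "'v \<Rightarrow>\<^sub>0 nat"
  assumes "v \<in> Poly_Mapping.keys m"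
  obtains r where "m = Poly_Mapping.single v 1 + r"
proof -
  have "Poly_Mapping.single v 1 + (m - Poly_Mapping.single v 1) = m"
    using assms by (intro poly_mapping_eqI) (auto simp: lookup_add lookup_minus lookup_single when_def in_keys_iff)
  then show ?thesis using that by metis
qed

text \<open>The additive map on exponents that takes the value \<open>g v\<close> on the variable
  \<open>v\<close>. The degree and every coordinate of a profile are of this form.\<close>

definition linear_ext :: "('v \<Rightarrow> nat) \<Rightarrow> ('v \<Rightarrow>\<^sub>0 nat) \<Rightarrow> nat"
  where "linear_ext g m = (\<Sum>v\<in>Poly_Mapping.keys m. Poly_Mapping.lookup m v * g v)"

lemma linear_ext_zero [simp]: "linear_ext g 0 = 0"
  by (simp add: linear_ext_def)

lemma linear_ext_single [simp]: "linear_ext g (Poly_Mapping.single v k) = k * g v"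
  by (simp add: linear_ext_def)

lemma linear_ext_add: "linear_ext g (m + m') = linear_ext g m + linear_ext g m'"
  unfolding linear_ext_def
  by (rule setsum_keys_plus_distrib[where f="\<lambda>v k. k * g v"]) (simp_all add: algebra_simps)

lemma linear_ext_sum: "linear_ext g (sum m A) = (\<Sum>a\<in>A. linear_ext g (m a))"
  by (induction A rule: infinite_finite_induct) (simp_all add: linear_ext_add)

lemma linear_ext_push_keys: "linear_ext g (push_keys f m) = linear_ext (\<lambda>v. g (f v)) m"
  by (simp add: push_keys_def linear_ext_sum) (simp add: linear_ext_def)

lemma linear_ext_cong:
  "m \<in> monomials V \<Longrightarrow> (\<And>v. v \<in> V \<Longrightarrow> g v = h v) \<Longrightarrow> linear_ext g m = linear_ext h m"
  by (auto simp: linear_ext_def monomials_def intro!: sum.cong)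

lemma linear_ext_eq_0_iff: "linear_ext g m = 0 \<longleftrightarrow> (\<forall>v\<in>Poly_Mapping.keys m. g v = 0)"
  by (simp add: linear_ext_def in_keys_iff)

text \<open>
  The monomial \<open>\<Prod>x\<^sub>\<alpha>\<close> of degree \<open>d\<close> restricts to the function \<open>\<Prod>\<^sub>s y\<^bsub>s,\<alpha>(s)\<^esub>\<close> on rank-one tensors
  \<open>\<Otimes>\<^sub>s y\<^sub>s\<close>; its profile consists of \<open>d\<close> and the exponents of the \<open>y\<^bsub>s,i\<^esub>\<close>. The degree is
  recorded separately for the sake of \<open>S = {}\<close>.
\<close>

type_synonym 's profile = "nat \<times> ('s \<Rightarrow> nat \<Rightarrow> nat)"

definition profile :: "'s set \<Rightarrow> (('s \<Rightarrow> nat) \<Rightarrow>\<^sub>0 nat) \<Rightarrow> 's profile"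
  where "profile S m =
    (linear_ext (\<lambda>_. 1) m, \<lambda>s i. if s \<in> S then linear_ext (\<lambda>\<alpha>. of_bool (\<alpha> s = i)) m else 0)"

definition profile_pull :: "'s set \<Rightarrow> ('s \<Rightarrow> 's) \<Rightarrow> 's profile \<Rightarrow> 's profile"
  where "profile_pull S \<pi> w = (fst w, \<lambda>s i. if s \<in> S then snd w (\<pi> s) i else 0)"

text \<open>The image of \<open>profile S\<close> on the monomials in the tensor variables. For
  \<open>S = {}\<close> only the degree remains, and it is arbitrary.\<close>

definition profiles :: "nat \<Rightarrow> 's set \<Rightarrow> 's profile set"
  where "profiles n S = {(d, w). (\<forall>s\<in>S. (\<Sum>i=1..n. w s i) = d) \<and> (\<forall>s i. s \<notin> S \<or> i \<notin> {1..n} \<longrightarrow> w s i = 0)}"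

lemma profile_zero [simp]: "profile S 0 = 0"
  by (simp add: profile_def zero_prod_def zero_fun_def fun_eq_iff)

lemma profile_add: "profile S (m + m') = profile S m + profile S m'"
  by (simp add: profile_def linear_ext_add plus_fun_def fun_eq_iff)

lemma profile_push_keys:
  assumes "\<pi> \<in> S \<rightarrow>\<^sub>E T"
  shows "profile S (push_keys (\<lambda>\<alpha>. compose S \<alpha> \<pi>) m) = profile_pull S \<pi> (profile T m)"
  using assms by (auto simp: profile_def profile_pull_def linear_ext_push_keys compose_def fun_eq_iff PiE_mem)

lemma profile_in_profiles:
  assumes "m \<in> monomials (S \<rightarrow>\<^sub>E {1..n})"
  shows "profile S m \<in> profiles n S"
proof -
  have "(\<Sum>i=1..n. linear_ext (\<lambda>\<alpha>. of_bool (\<alpha> s = i)) m) = linear_ext (\<lambda>_. 1) m" if "s \<in> S" for s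
  proof -
    have "(\<Sum>i=1..n. linear_ext (\<lambda>\<alpha>. of_bool (\<alpha> s = i)) m) = linear_ext (\<lambda>\<alpha>. \<Sum>i=1..n. of_bool (\<alpha> s = i)) m"
      unfolding linear_ext_def sum_distrib_left by (rule sum.swap)
    also have "\<dots> = linear_ext (\<lambda>_. 1) m"
    proof (rule linear_ext_cong[OF assms])
      fix \<alpha> assume "\<alpha> \<in> S \<rightarrow>\<^sub>E {1..n}"
      then have "\<alpha> s \<in> {1..n}" using that by (rule PiE_mem)
      then show "(\<Sum>i=1..n. of_bool (\<alpha> s = i)) = (1::nat)"
        by (simp add: of_bool_def sum.delta)
    qed
    finally show ?thesis .
  qed
  moreover have "linear_ext (\<lambda>\<alpha>. of_bool (\<alpha> s = i)) m = 0" if "s \<in> S" "i \<notin> {1..n}" for s i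
  proof -
    have "\<alpha> s \<noteq> i" if "\<alpha> \<in> Poly_Mapping.keys m" for \<alpha>
      using assms that \<open>s \<in> S\<close> \<open>i \<notin> {1..n}\<close> PiE_mem[of \<alpha> S "\<lambda>_. {1..n}" s] by (auto simp: monomials_def)
    then show ?thesis by (simp add: linear_ext_eq_0_iff)
  qed
  ultimately show ?thesis by (auto simp: profiles_def profile_def)
qed

text \<open>Choosing in each letter an index with positive exponent spells out a variable; splitting
  it off lowers all letter sums by one. The lemma later turns a difference of profiles into an
  actual monomial cofactor.\<close>

lemma profiles_realize:
  assumes "(d, w) \<in> profiles n S"
  shows "\<exists>m\<in>monomials (S \<rightarrow>\<^sub>E {1..n}). profile S m = (d, w)"
  using assms
proof (induction d arbitrary: w)
  case 0
  have "w s i = 0" for s i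
    using 0 by (cases "s \<in> S \<and> i \<in> {1..n}") (auto simp: profiles_def)
  then show ?case by (intro bexI[of _ 0]) (simp_all add: zero_prod_def zero_fun_def)
next
  case (Suc d)
  have "\<exists>i\<in>{1..n}. w s i > 0" if "s \<in> S" for s
  proof (rule ccontr)
    assume "\<not> ?thesis"
    then have "(\<Sum>i=1..n. w s i) = 0" by simp
    moreover have "(\<Sum>i=1..n. w s i) = Suc d" using Suc.prems that by (auto simp: profiles_def)
    ultimately show False by linarith
  qed
  then obtain f where f: "\<And>s. s \<in> S \<Longrightarrow> f s \<in> {1..n} \<and> w s (f s) > 0" by metis
  define \<alpha> where "\<alpha> = restrict f S"
  have \<alpha>: "\<alpha> \<in> S \<rightarrow>\<^sub>E {1..n}" "\<And>s. s \<in> S \<Longrightarrow> w s (\<alpha> s) > 0" "\<And>s. s \<in> S \<Longrightarrow> \<alpha> s \<in> {1..n}"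
    using f by (auto simp: \<alpha>_def)
  \<comment> \<open>The letters of the profile of the single variable \<alpha>.\<close>
  define e where "e s i = (if s \<in> S then of_bool (\<alpha> s = i) else 0 :: nat)" for s i
  define w' where "w' s i = w s i - e s i" for s i
  have e_le: "e s i \<le> w s i" for s i
    using \<alpha>(2)[of s] by (auto simp: e_def of_bool_def)
  have "(\<Sum>i=1..n. w' s i) = d" if "s \<in> S" for s
  proof -
    have "(\<Sum>i=1..n. w' s i) = (\<Sum>i=1..n. w s i) - (\<Sum>i=1..n. e s i)"
      unfolding w'_def by (rule sum_subtractf_nat) (simp add: e_le)
    moreover have "(\<Sum>i=1..n. e s i) = 1"
      using \<alpha>(3)[OF that] that by (simp add: e_def of_bool_def sum.delta)
    ultimately show ?thesis using Suc.prems that by (simp add: profiles_def)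
  qed
  then have "(d, w') \<in> profiles n S"
    using Suc.prems by (auto simp: profiles_def w'_def)
  then obtain m where m: "m \<in> monomials (S \<rightarrow>\<^sub>E {1..n})" "profile S m = (d, w')"
    using Suc.IH by blast
  have "profile S (Poly_Mapping.single \<alpha> 1) = (1, e)"
    by (auto simp: profile_def e_def fun_eq_iff)
  then have "profile S (Poly_Mapping.single \<alpha> 1 + m) = (Suc d, w)"
    using m(2) e_le by (simp add: profile_add fun_eq_iff w'_def)
  then show ?case
    using m(1) \<alpha>(1) by (intro bexI[of _ "Poly_Mapping.single \<alpha> 1 + m"]) (simp_all add: monomials_add monomials_single)
qed

section \<open>Ideals of polynomial algebras and the swap binomials\<close>

locale mpoly_ideal =
  fixes V :: "'v set" and I :: "('v, 'k::field) mpoly set"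
  assumes mpoly_ideal: "ideal I (mpoly_algebra V)"
begin

lemma zero_closed: "0 \<in> I"
  using additive_subgroup.zero_closed[OF ideal.axioms(1)[OF mpoly_ideal]] by simp

lemma add_closed: "p \<in> I \<Longrightarrow> q \<in> I \<Longrightarrow> p + q \<in> I"
  using additive_subgroup.a_closed[OF ideal.axioms(1)[OF mpoly_ideal], of p q] by simp

lemma mult_closed: "p \<in> I \<Longrightarrow> Poly_Mapping.keys q \<subseteq> monomials V \<Longrightarrow> q * p \<in> I"
  using ideal.I_l_closed[OF mpoly_ideal, of p q] by simp

lemma single_mult_closed: "p \<in> I \<Longrightarrow> m \<in> monomials V \<Longrightarrow> Poly_Mapping.single m c * p \<in> I"
  by (rule mult_closed) auto

lemma uminus_closed: "p \<in> I \<Longrightarrow> - p \<in> I"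
  using single_mult_closed[of p 0 "- 1"] by (simp add: single_uminus)

lemma diff_closed: "p \<in> I \<Longrightarrow> q \<in> I \<Longrightarrow> p - q \<in> I"
  using add_closed[of p "- q"] uminus_closed[of q] by simp

lemma sum_closed: "(\<And>a. a \<in> A \<Longrightarrow> p a \<in> I) \<Longrightarrow> sum p A \<in> I"
  by (induction A rule: infinite_finite_induct) (simp_all add: zero_closed add_closed)

lemma subset_carrier: "p \<in> I \<Longrightarrow> Poly_Mapping.keys p \<subseteq> monomials V"
  using ideal.Icarr[OF mpoly_ideal] by simp

definition cong_mod :: "('v \<Rightarrow>\<^sub>0 nat) \<Rightarrow> ('v \<Rightarrow>\<^sub>0 nat) \<Rightarrow> bool"
  where "cong_mod m m' \<longleftrightarrow> Poly_Mapping.single m 1 - Poly_Mapping.single m' 1 \<in> I"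

lemma cong_mod_refl: "cong_mod m m"
  by (simp add: cong_mod_def zero_closed)

lemma cong_mod_sym: "cong_mod m m' \<Longrightarrow> cong_mod m' m"
  using uminus_closed by (fastforce simp: cong_mod_def)

lemma cong_mod_trans: "cong_mod m m' \<Longrightarrow> cong_mod m' m'' \<Longrightarrow> cong_mod m m''"
  using add_closed by (fastforce simp: cong_mod_def)

lemma cong_mod_add:
  assumes "cong_mod m m'" "r \<in> monomials V"
  shows "cong_mod (r + m) (r + m')"
  using single_mult_closed[OF assms(1)[unfolded cong_mod_def] assms(2), of 1]
  by (simp add: cong_mod_def right_diff_distrib mult_single)

end

definition swap_binomials :: "nat \<Rightarrow> 's set \<Rightarrow> ('s \<Rightarrow> nat, 'k::field) mpoly set"
  where "swap_binomials n S = {var_mpoly (glue S\<^sub>1 \<alpha>\<^sub>1 \<alpha>\<^sub>2) * var_mpoly (glue S\<^sub>1 \<beta>\<^sub>1 \<beta>\<^sub>2)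
       - var_mpoly (glue S\<^sub>1 \<alpha>\<^sub>1 \<beta>\<^sub>2) * var_mpoly (glue S\<^sub>1 \<beta>\<^sub>1 \<alpha>\<^sub>2) |S\<^sub>1 S\<^sub>2 \<alpha>\<^sub>1 \<alpha>\<^sub>2 \<beta>\<^sub>1 \<beta>\<^sub>2.
       S\<^sub>1 \<union> S\<^sub>2 = S \<and> S\<^sub>1 \<inter> S\<^sub>2 = {} \<and>
       \<alpha>\<^sub>1 \<in> S\<^sub>1 \<rightarrow>\<^sub>E {1..n} \<and> \<beta>\<^sub>1 \<in> S\<^sub>1 \<rightarrow>\<^sub>E {1..n} \<and>
       \<alpha>\<^sub>2 \<in> S\<^sub>2 \<rightarrow>\<^sub>E {1..n} \<and> \<beta>\<^sub>2 \<in> S\<^sub>2 \<rightarrow>\<^sub>E {1..n}}"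

lemma rank_one_ideal_eq: "rank_one_ideal n S = Idl\<^bsub>tensor_algebra n S\<^esub> swap_binomials n S"
  by (simp add: rank_one_ideal_def swap_binomials_def)

lemma glue_closed:
  "\<lbrakk>S\<^sub>1 \<union> S\<^sub>2 = S; S\<^sub>1 \<inter> S\<^sub>2 = {}; \<alpha>\<^sub>1 \<in> S\<^sub>1 \<rightarrow>\<^sub>E A; \<alpha>\<^sub>2 \<in> S\<^sub>2 \<rightarrow>\<^sub>E A\<rbrakk> \<Longrightarrow> glue S\<^sub>1 \<alpha>\<^sub>1 \<alpha>\<^sub>2 \<in> S \<rightarrow>\<^sub>E A"
  by (auto simp: glue_def PiE_def extensional_def)

lemma var_mpoly_closed: "v \<in> V \<Longrightarrow> Poly_Mapping.keys (var_mpoly v) \<subseteq> monomials V"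
  by (simp add: var_mpoly_def monomials_single)

lemma mpoly_diff_closed:
  "Poly_Mapping.keys p \<subseteq> monomials V \<Longrightarrow> Poly_Mapping.keys q \<subseteq> monomials V \<Longrightarrow> Poly_Mapping.keys (p - q) \<subseteq> monomials V"
  using Poly_Mapping.keys_diff[of p q] by force

lemma swap_binomials_closed: "swap_binomials n S \<subseteq> carrier (tensor_algebra n S)"
proof
  fix p :: "('a \<Rightarrow> nat, 'b) mpoly" assume "p \<in> swap_binomials n S"
  then obtain S\<^sub>1 S\<^sub>2 \<alpha>\<^sub>1 \<alpha>\<^sub>2 \<beta>\<^sub>1 \<beta>\<^sub>2 where S: "S\<^sub>1 \<union> S\<^sub>2 = S" "S\<^sub>1 \<inter> S\<^sub>2 = {}"
    and closed: "\<alpha>\<^sub>1 \<in> S\<^sub>1 \<rightarrow>\<^sub>E {1..n}" "\<beta>\<^sub>1 \<in> S\<^sub>1 \<rightarrow>\<^sub>E {1..n}" "\<alpha>\<^sub>2 \<in> S\<^sub>2 \<rightarrow>\<^sub>E {1..n}" "\<beta>\<^sub>2 \<in> S\<^sub>2 \<rightarrow>\<^sub>E {1..n}"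
    and p: "p = var_mpoly (glue S\<^sub>1 \<alpha>\<^sub>1 \<alpha>\<^sub>2) * var_mpoly (glue S\<^sub>1 \<beta>\<^sub>1 \<beta>\<^sub>2)
       - var_mpoly (glue S\<^sub>1 \<alpha>\<^sub>1 \<beta>\<^sub>2) * var_mpoly (glue S\<^sub>1 \<beta>\<^sub>1 \<alpha>\<^sub>2)"
    unfolding swap_binomials_def by blast
  show "p \<in> carrier (tensor_algebra n S)"
    unfolding p tensor_algebra_def mpoly_algebra_simps(1)
    by (intro mpoly_diff_closed mpoly_mult_closed var_mpoly_closed glue_closed[OF S] closed)
qed

lemma rank_one_ideal_ideal:
  "ideal (rank_one_ideal n S) (tensor_algebra n S :: ('k::field, ('s \<Rightarrow> nat, 'k) mpoly) module)"
proof -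
  interpret cring "tensor_algebra n S :: ('k, ('s \<Rightarrow> nat, 'k) mpoly) module"
    unfolding tensor_algebra_def by (rule mpoly_algebra_cring)
  show ?thesis unfolding rank_one_ideal_eq by (rule genideal_ideal[OF swap_binomials_closed])
qed

lemma swap_binomials_subset: "swap_binomials n S \<subseteq> (rank_one_ideal n S :: ('s \<Rightarrow> nat, 'k::field) mpoly set)"
proof -
  interpret cring "tensor_algebra n S :: ('k, ('s \<Rightarrow> nat, 'k) mpoly) module"
    unfolding tensor_algebra_def by (rule mpoly_algebra_cring)
  show ?thesis unfolding rank_one_ideal_eq by (rule genideal_self[OF swap_binomials_closed])
qed

lemma tensor_pull_var: "tensor_pull S T \<pi> (var_mpoly \<alpha>) = var_mpoly (compose S \<alpha> \<pi>)"
  by (simp add: tensor_pull_eq var_mpoly_def)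

lemma tensor_pull_diff: "tensor_pull S T \<pi> (p - q) = tensor_pull S T \<pi> p - tensor_pull S T \<pi> q"
  by (simp add: tensor_pull_eq push_keys_diff)

lemma tensor_pull_mult: "tensor_pull S T \<pi> (p * q) = tensor_pull S T \<pi> p * tensor_pull S T \<pi> q"
  by (simp add: tensor_pull_eq push_keys_mult push_keys_add)

lemma compose_glue:
  assumes "\<pi> \<in> S \<rightarrow>\<^sub>E T" "T\<^sub>1 \<union> T\<^sub>2 = T" "T\<^sub>1 \<inter> T\<^sub>2 = {}"
  shows "compose S (glue T\<^sub>1 \<alpha>\<^sub>1 \<alpha>\<^sub>2) \<pi> =
    glue {s\<in>S. \<pi> s \<in> T\<^sub>1} (compose {s\<in>S. \<pi> s \<in> T\<^sub>1} \<alpha>\<^sub>1 \<pi>) (compose {s\<in>S. \<pi> s \<in> T\<^sub>2} \<alpha>\<^sub>2 \<pi>)"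
  using assms by (auto simp: compose_def glue_def fun_eq_iff restrict_def dest: PiE_mem)

text \<open>The preimages of the two parts of \<open>T\<close> partition \<open>S\<close>, and
  restricting \<alpha> to a part commutes with composing with \<pi>.\<close>

lemma tensor_pull_swap_binomials:
  assumes "\<pi> \<in> S \<rightarrow>\<^sub>E T"
  shows "tensor_pull S T \<pi> ` swap_binomials n T \<subseteq> swap_binomials n S"
proof clarify
  fix p :: "('a \<Rightarrow> nat, 'b) mpoly" assume "p \<in> swap_binomials n T"
  then obtain T\<^sub>1 T\<^sub>2 \<alpha>\<^sub>1 \<alpha>\<^sub>2 \<beta>\<^sub>1 \<beta>\<^sub>2 where T: "T\<^sub>1 \<union> T\<^sub>2 = T" "T\<^sub>1 \<inter> T\<^sub>2 = {}"
    and closed: "\<alpha>\<^sub>1 \<in> T\<^sub>1 \<rightarrow>\<^sub>E {1..n}" "\<beta>\<^sub>1 \<in> T\<^sub>1 \<rightarrow>\<^sub>E {1..n}" "\<alpha>\<^sub>2 \<in> T\<^sub>2 \<rightarrow>\<^sub>E {1..n}" "\<beta>\<^sub>2 \<in> T\<^sub>2 \<rightarrow>\<^sub>E {1..n}"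
    and p: "p = var_mpoly (glue T\<^sub>1 \<alpha>\<^sub>1 \<alpha>\<^sub>2) * var_mpoly (glue T\<^sub>1 \<beta>\<^sub>1 \<beta>\<^sub>2)
       - var_mpoly (glue T\<^sub>1 \<alpha>\<^sub>1 \<beta>\<^sub>2) * var_mpoly (glue T\<^sub>1 \<beta>\<^sub>1 \<alpha>\<^sub>2)"
    unfolding swap_binomials_def by blast
  define S\<^sub>1 where "S\<^sub>1 = {s\<in>S. \<pi> s \<in> T\<^sub>1}"
  define S\<^sub>2 where "S\<^sub>2 = {s\<in>S. \<pi> s \<in> T\<^sub>2}"
  have "S\<^sub>1 \<union> S\<^sub>2 = S" "S\<^sub>1 \<inter> S\<^sub>2 = {}"
    using T assms PiE_mem[OF assms] by (auto simp: S\<^sub>1_def S\<^sub>2_def)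
  moreover have "compose S\<^sub>1 \<alpha>\<^sub>1 \<pi> \<in> S\<^sub>1 \<rightarrow>\<^sub>E {1..n}" "compose S\<^sub>1 \<beta>\<^sub>1 \<pi> \<in> S\<^sub>1 \<rightarrow>\<^sub>E {1..n}"
    "compose S\<^sub>2 \<alpha>\<^sub>2 \<pi> \<in> S\<^sub>2 \<rightarrow>\<^sub>E {1..n}" "compose S\<^sub>2 \<beta>\<^sub>2 \<pi> \<in> S\<^sub>2 \<rightarrow>\<^sub>E {1..n}"
    using closed by (auto simp: compose_def S\<^sub>1_def S\<^sub>2_def)
  moreover have "tensor_pull S T \<pi> p =
      var_mpoly (glue S\<^sub>1 (compose S\<^sub>1 \<alpha>\<^sub>1 \<pi>) (compose S\<^sub>2 \<alpha>\<^sub>2 \<pi>)) * var_mpoly (glue S\<^sub>1 (compose S\<^sub>1 \<beta>\<^sub>1 \<pi>) (compose S\<^sub>2 \<beta>\<^sub>2 \<pi>))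
      - var_mpoly (glue S\<^sub>1 (compose S\<^sub>1 \<alpha>\<^sub>1 \<pi>) (compose S\<^sub>2 \<beta>\<^sub>2 \<pi>)) * var_mpoly (glue S\<^sub>1 (compose S\<^sub>1 \<beta>\<^sub>1 \<pi>) (compose S\<^sub>2 \<alpha>\<^sub>2 \<pi>))"
    by (simp add: p tensor_pull_diff tensor_pull_mult tensor_pull_var compose_glue[OF assms T] S\<^sub>1_def S\<^sub>2_def)
  ultimately show "tensor_pull S T \<pi> p \<in> swap_binomials n S"
    unfolding swap_binomials_def by blast
qed

lemma rank_one_fin_op_ideal:
  "fin_op_ideal (tensor_algebra n :: 's set \<Rightarrow> ('k::field, ('s \<Rightarrow> nat, 'k) mpoly) module) tensor_pull (rank_one_ideal n)"
  unfolding fin_op_ideal_def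
proof (intro conjI allI impI ballI)
  fix S T :: "'s set" and \<pi> assume \<pi>: "\<pi> \<in> S \<rightarrow>\<^sub>E T"
  interpret T: cring "tensor_algebra n T :: ('k, ('s \<Rightarrow> nat, 'k) mpoly) module"
    unfolding tensor_algebra_def by (rule mpoly_algebra_cring)
  interpret S: cring "tensor_algebra n S :: ('k, ('s \<Rightarrow> nat, 'k) mpoly) module"
    unfolding tensor_algebra_def by (rule mpoly_algebra_cring)
  interpret ring_hom_ring "tensor_algebra n T" "tensor_algebra n S" "tensor_pull S T \<pi> :: ('s \<Rightarrow> nat, 'k) mpoly \<Rightarrow> _"
    using tensor_pull_hom[OF \<pi>] T.ring_axioms S.ring_axioms by (intro ring_hom_ringI2)
  \<comment> \<open>The preimage of an ideal is an ideal, so it suffices to know that it contains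
    the generating binomials.\<close>
  let ?P = "{p \<in> carrier (tensor_algebra n T). tensor_pull S T \<pi> p \<in> (rank_one_ideal n S :: ('s \<Rightarrow> nat, 'k) mpoly set)}"
  have "ideal ?P (tensor_algebra n T)"
    by (rule ideal_vimage[OF rank_one_ideal_ideal])
  moreover have "swap_binomials n T \<subseteq> ?P"
    using swap_binomials_closed[of n T] tensor_pull_swap_binomials[OF \<pi>, of n] swap_binomials_subset[of n S] by blast
  ultimately have "rank_one_ideal n T \<subseteq> ?P"
    unfolding rank_one_ideal_eq[of n T] by (rule T.genideal_minimal)
  then show "tensor_pull S T \<pi> ` rank_one_ideal n T \<subseteq> (rank_one_ideal n S :: ('s \<Rightarrow> nat, 'k) mpoly set)" by blast
qed (rule rank_one_ideal_ideal)

section \<open>Monomials with equal profiles are congruent modulo the binomials\<close>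

locale rank_one_ideal_at =
  fixes n :: nat and S :: "'s set" and I :: "('s \<Rightarrow> nat, 'k::field) mpoly set"
  assumes finite: "finite S"
  defines "I \<equiv> rank_one_ideal n S"
begin

sublocale mpoly_ideal "S \<rightarrow>\<^sub>E {1..n}" I
  unfolding mpoly_ideal_def I_def using rank_one_ideal_ideal[of n S] unfolding tensor_algebra_def .

text \<open>This is the binomial of the partition of \<open>S\<close> into \<open>{s}\<close> and
  \<open>S - {s}\<close>.\<close>

lemma cong_mod_swap:
  assumes \<alpha>: "\<alpha> \<in> S \<rightarrow>\<^sub>E {1..n}" and \<beta>: "\<beta> \<in> S \<rightarrow>\<^sub>E {1..n}" and s: "s \<in> S"
  shows "cong_mod (Poly_Mapping.single \<alpha> 1 + Poly_Mapping.single \<beta> 1)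
    (Poly_Mapping.single (\<alpha>(s := \<beta> s)) 1 + Poly_Mapping.single (\<beta>(s := \<alpha> s)) 1)"
proof -
  define \<alpha>\<^sub>1 \<beta>\<^sub>1 \<alpha>\<^sub>2 \<beta>\<^sub>2 where "\<alpha>\<^sub>1 = restrict \<alpha> {s}" and "\<beta>\<^sub>1 = restrict \<beta> {s}"
    and "\<alpha>\<^sub>2 = restrict \<alpha> (S - {s})" and "\<beta>\<^sub>2 = restrict \<beta> (S - {s})"
  note defs = this
  have "\<alpha>\<^sub>1 \<in> {s} \<rightarrow>\<^sub>E {1..n}" "\<beta>\<^sub>1 \<in> {s} \<rightarrow>\<^sub>E {1..n}"
    "\<alpha>\<^sub>2 \<in> S - {s} \<rightarrow>\<^sub>E {1..n}" "\<beta>\<^sub>2 \<in> S - {s} \<rightarrow>\<^sub>E {1..n}" "{s} \<union> (S - {s}) = S" "{s} \<inter> (S - {s}) = {}"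
    using \<alpha> \<beta> s by (auto simp: defs restrict_PiE_iff dest: PiE_mem)
  then have "var_mpoly (glue {s} \<alpha>\<^sub>1 \<alpha>\<^sub>2) * var_mpoly (glue {s} \<beta>\<^sub>1 \<beta>\<^sub>2)
      - var_mpoly (glue {s} \<alpha>\<^sub>1 \<beta>\<^sub>2) * var_mpoly (glue {s} \<beta>\<^sub>1 \<alpha>\<^sub>2) \<in> (swap_binomials n S :: ('s \<Rightarrow> nat, 'k) mpoly set)"
    unfolding swap_binomials_def by blast
  moreover have "glue {s} \<alpha>\<^sub>1 \<alpha>\<^sub>2 = \<alpha>" "glue {s} \<beta>\<^sub>1 \<beta>\<^sub>2 = \<beta>"
    "glue {s} \<alpha>\<^sub>1 \<beta>\<^sub>2 = \<beta>(s := \<alpha> s)" "glue {s} \<beta>\<^sub>1 \<alpha>\<^sub>2 = \<alpha>(s := \<beta> s)"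
    using \<alpha> \<beta> by (auto simp: defs glue_def fun_eq_iff PiE_def extensional_def)
  ultimately have "var_mpoly \<alpha> * var_mpoly \<beta> - var_mpoly (\<beta>(s := \<alpha> s)) * var_mpoly (\<alpha>(s := \<beta> s)) \<in> I"
    using swap_binomials_subset unfolding I_def by auto
  then show ?thesis
    by (simp add: cong_mod_def var_mpoly_def mult_single add.commute)
qed

lemma profile_swap:
  "profile S (Poly_Mapping.single (\<alpha>(s := \<beta> s)) 1 + Poly_Mapping.single (\<beta>(s := \<alpha> s)) 1) =
    profile S (Poly_Mapping.single \<alpha> 1 + Poly_Mapping.single \<beta> 1)"
  by (auto simp: profile_def linear_ext_add fun_eq_iff)

text \<open>Swapping entries between two factors moves a prescribed \<open>\<alpha>\<close> into the support of \<open>m\<close>.\<close>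

lemma align:
  assumes m: "m \<in> monomials (S \<rightarrow>\<^sub>E {1..n})" "m \<noteq> 0"
    and \<alpha>: "\<And>s. s \<in> S \<Longrightarrow> snd (profile S m) s (\<alpha> s) > 0"
    and "U \<subseteq> S"
  shows "\<exists>m'\<in>monomials (S \<rightarrow>\<^sub>E {1..n}). profile S m' = profile S m \<and> cong_mod m m' \<and>
    (\<exists>\<beta>\<in>Poly_Mapping.keys m'. \<forall>s\<in>U. \<beta> s = \<alpha> s)"
proof -
  have "finite U" using \<open>U \<subseteq> S\<close> finite by (rule finite_subset)
  then show ?thesis using \<open>U \<subseteq> S\<close>
  proof (induction U)
    case empty
    obtain \<beta> where "\<beta> \<in> Poly_Mapping.keys m" using \<open>m \<noteq> 0\<close> by fastforce
    then show ?case using m cong_mod_refl by blast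
  next
    case (insert s U)
    then obtain m' \<beta> where m': "m' \<in> monomials (S \<rightarrow>\<^sub>E {1..n})" "profile S m' = profile S m" "cong_mod m m'"
      and \<beta>: "\<beta> \<in> Poly_Mapping.keys m'" "\<forall>t\<in>U. \<beta> t = \<alpha> t" by auto
    show ?case
    proof (cases "\<beta> s = \<alpha> s")
      case True
      then show ?thesis using m' \<beta> by (intro bexI[of _ m'] conjI bexI[of _ \<beta>]) auto
    next
      case False
      have "s \<in> S" using insert.prems by simp
      \<comment> \<open>This exponent is part of the profile, which \<open>m'\<close> shares with
        \<open>m\<close>. Its positivity yields a factor \<gamma> with the wanted entry at
        \<open>s\<close>, distinct from \<beta>; exchanging the entries at \<open>s\<close> leaves
        the agreement on \<open>U\<close> intact because \<open>s\<close> is not in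
        \<open>U\<close>.\<close>
      then have "linear_ext (\<lambda>\<gamma>. of_bool (\<gamma> s = \<alpha> s)) m' > 0"
        using \<alpha>[of s] unfolding m'(2)[symmetric] by (simp add: profile_def)
      then obtain \<gamma> where \<gamma>: "\<gamma> \<in> Poly_Mapping.keys m'" "\<gamma> s = \<alpha> s"
        by (auto simp: linear_ext_eq_0_iff neq0_conv[symmetric] simp del: neq0_conv)
      obtain r' where r': "m' = Poly_Mapping.single \<beta> 1 + r'"
        using \<beta>(1) by (rule single_split)
      have "\<gamma> \<noteq> \<beta>" using False \<gamma>(2) by metis
      then have "\<gamma> \<in> Poly_Mapping.keys r'"
        using \<gamma>(1) by (auto simp: r' in_keys_iff lookup_add lookup_single when_def)
      then obtain r where "r' = Poly_Mapping.single \<gamma> 1 + r"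
        by (rule single_split)
      then have r: "m' = r + (Poly_Mapping.single \<beta> 1 + Poly_Mapping.single \<gamma> 1)"
        by (simp add: r' algebra_simps)
      define m'' where "m'' = r + (Poly_Mapping.single (\<beta>(s := \<gamma> s)) 1 + Poly_Mapping.single (\<gamma>(s := \<beta> s)) 1)"
      have closed: "\<beta> \<in> S \<rightarrow>\<^sub>E {1..n}" "\<gamma> \<in> S \<rightarrow>\<^sub>E {1..n}" "r \<in> monomials (S \<rightarrow>\<^sub>E {1..n})"
        using m'(1) \<beta>(1) \<gamma>(1) monomials_addD[of r] r by (auto simp: monomials_def)
      have "\<beta>(s := \<gamma> s) \<in> S \<rightarrow>\<^sub>E {1..n}" "\<gamma>(s := \<beta> s) \<in> S \<rightarrow>\<^sub>E {1..n}"
        using closed \<open>s \<in> S\<close> PiE_fun_upd[of _ "\<lambda>_. {1..n}" s _ S] PiE_mem[of _ S "\<lambda>_. {1..n}" s]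
        by (simp_all only: insert_absorb)
      then have "m'' \<in> monomials (S \<rightarrow>\<^sub>E {1..n})"
        unfolding m''_def using closed(3) by (intro monomials_add monomials_single)
      moreover have "profile S m'' = profile S m"
        unfolding m'(2)[symmetric] r m''_def profile_add[of S r] profile_swap ..
      moreover have "cong_mod m m''"
        using m'(3) cong_mod_add[OF cong_mod_swap[OF closed(1,2) \<open>s \<in> S\<close>] closed(3)]
        unfolding r m''_def by (rule cong_mod_trans)
      moreover have "\<beta>(s := \<gamma> s) \<in> Poly_Mapping.keys m''"
        by (simp add: m''_def in_keys_iff lookup_add)
      moreover have "\<forall>t\<in>insert s U. (\<beta>(s := \<gamma> s)) t = \<alpha> t"
        using \<beta>(2) \<gamma>(2) by auto
      ultimately show ?thesis by blast
    qed
  qed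
qed

text \<open>Induction on the degree. All entries of a factor \<alpha> of \<open>m\<close> occur in
  the common profile, so swaps make \<alpha> a factor of a monomial congruent to \<open>m'\<close>.
  Removing \<alpha> from both sides leaves equal profiles, as addition of profiles is
  cancellative.\<close>

lemma cong_mod_if_profile_eq:
  assumes "m \<in> monomials (S \<rightarrow>\<^sub>E {1..n})" "m' \<in> monomials (S \<rightarrow>\<^sub>E {1..n})" "profile S m = profile S m'"
  shows "cong_mod m m'"
  using assms
proof (induction "linear_ext (\<lambda>_. 1) m" arbitrary: m m')
  case 0
  then have "linear_ext (\<lambda>_. 1) m = 0" "linear_ext (\<lambda>_. 1) m' = 0"
    by (simp_all add: profile_def)
  then have "m = 0" "m' = 0" by (simp_all add: linear_ext_eq_0_iff keys_eq_empty)
  then show ?case by (simp add: cong_mod_refl)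
next
  case (Suc d)
  then have "Poly_Mapping.keys m \<noteq> {}" by (auto simp: linear_ext_def)
  then obtain \<alpha> where \<alpha>: "\<alpha> \<in> Poly_Mapping.keys m" by blast
  obtain r where r: "m = Poly_Mapping.single \<alpha> 1 + r" using \<alpha> by (rule single_split)
  have \<alpha>_closed: "\<alpha> \<in> S \<rightarrow>\<^sub>E {1..n}" using \<alpha> Suc.prems(1) by (auto simp: monomials_def)
  have "linear_ext (\<lambda>_. 1) m' = Suc d" using Suc by (simp add: profile_def)
  then have "m' \<noteq> 0" by auto
  moreover have "snd (profile S m') s (\<alpha> s) > 0" if "s \<in> S" for s
    using that \<alpha> unfolding Suc.prems(3)[symmetric]
    by (auto simp: profile_def linear_ext_eq_0_iff neq0_conv[symmetric] simp del: neq0_conv)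
  ultimately obtain m'' \<beta> where m'': "m'' \<in> monomials (S \<rightarrow>\<^sub>E {1..n})" "profile S m'' = profile S m'" "cong_mod m' m''"
    and \<beta>: "\<beta> \<in> Poly_Mapping.keys m''" "\<forall>s\<in>S. \<beta> s = \<alpha> s"
    using align[OF Suc.prems(2), of \<alpha> S] by blast
  have "\<beta> \<in> S \<rightarrow>\<^sub>E {1..n}" using \<beta>(1) m''(1) by (auto simp: monomials_def)
  then have "\<beta> = \<alpha>" using \<alpha>_closed \<beta>(2) by (metis PiE_ext)
  obtain r' where r': "m'' = Poly_Mapping.single \<alpha> 1 + r'"
    using \<beta>(1) unfolding \<open>\<beta> = \<alpha>\<close> by (rule single_split)
  have "profile S r = profile S r'"
    using Suc.prems(3) m''(2) unfolding r r' profile_add by (metis add_left_cancel)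
  moreover have "d = linear_ext (\<lambda>_. 1) r" using Suc.hyps(2) by (simp add: r linear_ext_add)
  moreover have "r \<in> monomials (S \<rightarrow>\<^sub>E {1..n})" "r' \<in> monomials (S \<rightarrow>\<^sub>E {1..n})"
    using Suc.prems(1) m''(1) monomials_addD unfolding r r' by blast+
  ultimately have "cong_mod r r'" using Suc.hyps(1) by blast
  then have "cong_mod m m''"
    unfolding r r' using \<alpha>_closed by (intro cong_mod_add monomials_single)
  then show ?case using cong_mod_sym[OF m''(3)] by (rule cong_mod_trans)
qed

text \<open>Replacing each monomial by a fixed representative of its profile changes
  \<open>p\<close> by an element of \<open>I\<close>. The result depends only on the image of
  \<open>p\<close> in the monoid algebra of profiles, so it vanishes with that image.\<close>

lemma kernel_subset:
  assumes p: "Poly_Mapping.keys p \<subseteq> monomials (S \<rightarrow>\<^sub>E {1..n})" and "push_keys (profile S) p = 0"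
  shows "p \<in> I"
proof -
  define rep where "rep w = (SOME m. m \<in> monomials (S \<rightarrow>\<^sub>E {1..n}) \<and> profile S m = w)" for w
  have rep: "rep (profile S m) \<in> monomials (S \<rightarrow>\<^sub>E {1..n}) \<and> profile S (rep (profile S m)) = profile S m"
    if "m \<in> monomials (S \<rightarrow>\<^sub>E {1..n})" for m
    unfolding rep_def by (rule someI[of _ m]) (use that in blast)
  have "push_keys (\<lambda>m. rep (profile S m)) p = push_keys rep (push_keys (profile S) p)"
    by (simp add: push_keys_push_keys)
  also have "\<dots> = 0" by (simp add: assms)
  finally have "p = p - push_keys (\<lambda>m. rep (profile S m)) p" by simp
  also have "\<dots> = (\<Sum>m\<in>Poly_Mapping.keys p. Poly_Mapping.single 0 (Poly_Mapping.lookup p m) *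
      (Poly_Mapping.single m 1 - Poly_Mapping.single (rep (profile S m)) 1))"
    by (subst (1) sum_singles[of p, symmetric])
      (simp add: push_keys_def right_diff_distrib mult_single sum_subtractf)
  also have "\<dots> \<in> I"
  proof (rule sum_closed)
    fix m assume "m \<in> Poly_Mapping.keys p"
    then have m: "m \<in> monomials (S \<rightarrow>\<^sub>E {1..n})" using p by blast
    then have "cong_mod m (rep (profile S m))"
      using rep cong_mod_if_profile_eq by metis
    then show "Poly_Mapping.single 0 (Poly_Mapping.lookup p m) *
        (Poly_Mapping.single m 1 - Poly_Mapping.single (rep (profile S m)) 1) \<in> I"
      unfolding cong_mod_def by (rule single_mult_closed) simp
  qed
  finally show ?thesis .
qed

end


section \<open>Division with remainder\<close>

text \<open>The last element of the list is the most significant one.\<close>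

primrec lex_less :: "('b \<Rightarrow> 'b \<Rightarrow> bool) \<Rightarrow> 'a list \<Rightarrow> ('a \<Rightarrow> 'b) \<Rightarrow> ('a \<Rightarrow> 'b) \<Rightarrow> bool"
  where
    "lex_less r [] p q = False"
  | "lex_less r (x # xs) p q = (lex_less r xs p q \<or> (\<forall>y\<in>set xs. p y = q y) \<and> r (p x) (q x))"

lemma lex_less_cong:
  "(\<And>x. x \<in> set xs \<Longrightarrow> p x = p' x) \<Longrightarrow> (\<And>x. x \<in> set xs \<Longrightarrow> q x = q' x) \<Longrightarrow>
    lex_less r xs p q \<longleftrightarrow> lex_less r xs p' q'"
  by (induction xs) auto

lemma lex_less_irrefl: "(\<And>a. \<not> r a a) \<Longrightarrow> \<not> lex_less r xs p p"
  by (induction xs) auto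

lemma lex_less_trans:
  assumes r: "\<And>a b c. r a b \<Longrightarrow> r b c \<Longrightarrow> r a c"
  shows "lex_less r xs p q \<Longrightarrow> lex_less r xs q q' \<Longrightarrow> lex_less r xs p q'"
proof (induction xs)
  case (Cons x xs)
  have "lex_less r xs p q'" if "lex_less r xs q q'" "\<forall>y\<in>set xs. p y = q y"
    using that lex_less_cong[of xs p q q' q' r] by auto
  moreover have "lex_less r xs p q'" if "lex_less r xs p q" "\<forall>y\<in>set xs. q y = q' y"
    using that lex_less_cong[of xs p p q q' r] by auto
  ultimately show ?case using Cons r[of "p x" "q x" "q' x"] by auto
qed simp

lemma lex_less_total:
  assumes "\<And>x. x \<in> set xs \<Longrightarrow> p x \<noteq> q x \<Longrightarrow> r (p x) (q x) \<or> r (q x) (p x)"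
  shows "lex_less r xs p q \<or> lex_less r xs q p \<or> (\<forall>x\<in>set xs. p x = q x)"
  using assms by (induction xs) auto

lemma lex_less_add:
  fixes c p q :: "'a \<Rightarrow> 'b::plus"
  assumes "\<And>a b c. r a b \<Longrightarrow> r (c + a) (c + b)"
  shows "lex_less r xs p q \<Longrightarrow> lex_less r xs (c + p) (c + q)"
  using assms by (induction xs) auto

lemma wf_lex_less:
  assumes "wf {(a, b). r a b}"
  shows "wf {(p, q). lex_less r xs p q}"
proof (induction xs)
  case (Cons x xs)
  \<comment> \<open>The lexicographic product asks for equality of the first components, whereas
    \<open>lex_less\<close> compares only values on \<open>set xs\<close>; hence the
    restriction.\<close>
  have "{(p, q). lex_less r (x # xs) p q} \<subseteq>
      inv_image ({(p, q). lex_less r xs p q} <*lex*> {(a, b). r a b}) (\<lambda>p. (restrict p (set xs), p x))"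
  proof -
    have "restrict p (set xs) = restrict q (set xs)" if "\<forall>y\<in>set xs. p y = q y" for p q :: "'b \<Rightarrow> 'a"
      using that by auto
    moreover have "lex_less r xs (restrict p (set xs)) (restrict q (set xs)) = lex_less r xs p q" for p q
      by (rule lex_less_cong) auto
    ultimately show ?thesis by auto
  qed
  moreover have "wf (inv_image ({(p, q). lex_less r xs p q} <*lex*> {(a, b). r a b}) (\<lambda>p. (restrict p (set xs), p x)))"
    using Cons assms by blast
  ultimately show ?case by (rule wf_subset[rotated])
qed simp

text \<open>
  Read from the end, \<open>surj_emb\<close> gives a surjection under which the positions of the first preimages
  increase; such surjections preserve the lexicographic order.
\<close>

lemma surj_emb_map:
  assumes "surj_emb below (map u xs) (map v ys)" "distinct ys"
  shows "\<exists>\<pi>\<in>set ys \<rightarrow>\<^sub>E set xs. (\<forall>t\<in>set ys. below (u (\<pi> t)) (v t)) \<and>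
    (\<forall>p q. lex_less r xs p q \<longrightarrow> lex_less r ys (\<lambda>t. p (\<pi> t)) (\<lambda>t. q (\<pi> t)))"
  using assms
proof (induction "map u xs" "map v ys" arbitrary: xs ys)
  case nil
  then show ?case by simp
next
  case (keep a b us vs)
  obtain x xs' where xs: "xs = x # xs'" "a = u x" "us = map u xs'" using keep.hyps(4) by (cases xs) auto
  obtain y ys' where ys: "ys = y # ys'" "b = v y" "vs = map v ys'" using keep.hyps(5) by (cases ys) auto
  obtain \<pi> where \<pi>: "\<pi> \<in> set ys' \<rightarrow>\<^sub>E set xs'" "\<forall>t\<in>set ys'. below (u (\<pi> t)) (v t)"
      "\<And>p q. lex_less r xs' p q \<Longrightarrow> lex_less r ys' (\<lambda>t. p (\<pi> t)) (\<lambda>t. q (\<pi> t))"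
    using keep.hyps(3)[OF xs(3) ys(3)] keep.prems ys(1) by auto
  have y: "y \<notin> set ys'" using keep.prems ys(1) by simp
  show ?case
  proof (intro bexI[of _ "\<pi>(y := x)"] conjI ballI allI impI)
    show "\<pi>(y := x) \<in> set ys \<rightarrow>\<^sub>E set xs"
      using \<pi>(1) by (auto simp: xs ys PiE_def extensional_def Pi_iff)
    fix t assume "t \<in> set ys"
    then show "below (u ((\<pi>(y := x)) t)) (v t)" using \<pi>(2) keep.hyps(1) by (auto simp: xs ys)
  next
    \<comment> \<open>If \<open>p\<close> and \<open>q\<close> differ on \<open>xs'\<close>, the
      induction hypothesis decides on \<open>ys'\<close>. Otherwise they agree along \<pi> on
      \<open>ys'\<close>, whose image lies in \<open>xs'\<close>, and \<open>y\<close> decides as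
      \<open>x\<close> does.\<close>
    fix p q assume "lex_less r xs p q"
    moreover have "lex_less r ys' (\<lambda>t. p ((\<pi>(y := x)) t)) (\<lambda>t. q ((\<pi>(y := x)) t))" if "lex_less r xs' p q"
      using \<pi>(3)[OF that] y by (subst lex_less_cong[where p' = "\<lambda>t. p (\<pi> t)" and q' = "\<lambda>t. q (\<pi> t)"]) auto
    ultimately show "lex_less r ys (\<lambda>t. p ((\<pi>(y := x)) t)) (\<lambda>t. q ((\<pi>(y := x)) t))"
      using y PiE_mem[OF \<pi>(1)] by (auto simp: xs ys)
  qed
next
  case (skip a b vs)
  obtain y ys' where ys: "ys = y # ys'" "b = v y" "vs = map v ys'" using skip.hyps(5) by (cases ys) auto
  obtain x where x: "x \<in> set xs" "a = u x" using skip.hyps(1) by auto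
  obtain \<pi> where \<pi>: "\<pi> \<in> set ys' \<rightarrow>\<^sub>E set xs" "\<forall>t\<in>set ys'. below (u (\<pi> t)) (v t)"
      "\<And>p q. lex_less r xs p q \<Longrightarrow> lex_less r ys' (\<lambda>t. p (\<pi> t)) (\<lambda>t. q (\<pi> t))"
    using skip.hyps(4)[OF refl ys(3)] skip.prems ys(1) by auto
  have y: "y \<notin> set ys'" using skip.prems ys(1) by simp
  show ?case
  proof (intro bexI[of _ "\<pi>(y := x)"] conjI ballI allI impI)
    show "\<pi>(y := x) \<in> set ys \<rightarrow>\<^sub>E set xs"
      using \<pi>(1) x(1) by (auto simp: ys PiE_def extensional_def)
    fix t assume "t \<in> set ys"
    then show "below (u ((\<pi>(y := x)) t)) (v t)" using \<pi>(2) skip.hyps(2) x by (auto simp: ys)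
  next
    \<comment> \<open>The added position \<open>y\<close> is the least significant one, so the
      strict inequality on \<open>ys'\<close> persists whatever happens at \<open>y\<close>.\<close>
    fix p q assume "lex_less r xs p q"
    then have "lex_less r ys' (\<lambda>t. p ((\<pi>(y := x)) t)) (\<lambda>t. q ((\<pi>(y := x)) t))"
      using \<pi>(3)[of p q] y by (subst lex_less_cong[where p' = "\<lambda>t. p (\<pi> t)" and q' = "\<lambda>t. q (\<pi> t)"]) auto
    then show "lex_less r ys (\<lambda>t. p ((\<pi>(y := x)) t)) (\<lambda>t. q ((\<pi>(y := x)) t))"
      by (simp add: ys)
  qed
qed

section \<open>The term order on profiles\<close>

abbreviation letter_less :: "nat \<Rightarrow> (nat \<Rightarrow> nat) \<Rightarrow> (nat \<Rightarrow> nat) \<Rightarrow> bool"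
  where "letter_less n \<equiv> lex_less (<) [1..<Suc n]"

definition profile_less :: "nat \<Rightarrow> 's list \<Rightarrow> 's profile \<Rightarrow> 's profile \<Rightarrow> bool"
  where "profile_less n xs a b \<longleftrightarrow>
    fst a < fst b \<or> fst a = fst b \<and> lex_less (letter_less n) xs (snd a) (snd b)"

lemma wf_profile_less: "wf {(a, b). profile_less n xs a b}"
proof (rule wf_subset)
  have "wf {(p, q). lex_less (letter_less n) xs p q}"
    by (intro wf_lex_less) (rule wf)
  then show "wf (less_than <*lex*> {(p, q). lex_less (letter_less n) xs p q})" by blast
qed (auto simp: profile_less_def)

lemma profile_less_irrefl: "\<not> profile_less n xs a a"
  by (simp add: profile_less_def lex_less_irrefl)

lemma profile_less_trans: "profile_less n xs a b \<Longrightarrow> profile_less n xs b c \<Longrightarrow> profile_less n xs a c"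
proof -
  have "letter_less n u v \<Longrightarrow> letter_less n v w \<Longrightarrow> letter_less n u w" for u v w
    by (rule lex_less_trans) auto
  from lex_less_trans[of "letter_less n", OF this]
  show "profile_less n xs a b \<Longrightarrow> profile_less n xs b c \<Longrightarrow> profile_less n xs a c"
    unfolding profile_less_def by (auto intro: less_trans)
qed

lemma profile_less_add: "profile_less n xs a b \<Longrightarrow> profile_less n xs (c + a) (c + b)"
proof -
  have "letter_less n u v \<Longrightarrow> letter_less n (w + u) (w + v)" for u v w
    by (rule lex_less_add) auto
  from lex_less_add[of "letter_less n", OF this]
  show "profile_less n xs a b \<Longrightarrow> profile_less n xs (c + a) (c + b)"
    unfolding profile_less_def by auto
qed

text \<open>The comparison sees only positions in \<open>set xs\<close> and indices in
  \<open>{1..n}\<close>; elsewhere all profiles over \<open>set xs\<close> vanish.\<close>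

lemma profile_less_total:
  assumes "a \<in> profiles n (set xs)" "b \<in> profiles n (set xs)" "a \<noteq> b"
  shows "profile_less n xs a b \<or> profile_less n xs b a"
proof -
  have support: "snd w s i = 0" if "w \<in> profiles n (set xs)" "s \<notin> set xs \<or> i \<notin> set [1..<Suc n]" for w s i
    using that by (auto simp: profiles_def)
  have letter_eq: "snd a s = snd b s" if "\<forall>i\<in>set [1..<Suc n]. snd a s i = snd b s i" for s
  proof
    fix i
    show "snd a s i = snd b s i"
      using that support[OF assms(1), of s i] support[OF assms(2), of s i] by (cases "i \<in> set [1..<Suc n]") auto
  qed
  have "lex_less (letter_less n) xs (snd a) (snd b) \<or> lex_less (letter_less n) xs (snd b) (snd a) \<or>
      (\<forall>s\<in>set xs. snd a s = snd b s)"
  proof (rule lex_less_total)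
    fix s assume "snd a s \<noteq> snd b s"
    then have "\<not> (\<forall>i\<in>set [1..<Suc n]. snd a s i = snd b s i)" using letter_eq by blast
    moreover have "letter_less n (snd a s) (snd b s) \<or> letter_less n (snd b s) (snd a s) \<or>
        (\<forall>i\<in>set [1..<Suc n]. snd a s i = snd b s i)"
      by (rule lex_less_total) (simp only: nat_neq_iff)
    ultimately show "letter_less n (snd a s) (snd b s) \<or> letter_less n (snd b s) (snd a s)"
      by blast
  qed
  moreover have "snd a = snd b" if "\<forall>s\<in>set xs. snd a s = snd b s"
  proof (intro HOL.ext)
    fix s i
    show "snd a s i = snd b s i"
      using that support[OF assms(1), of s i] support[OF assms(2), of s i] by (cases "s \<in> set xs") auto
  qed
  moreover have "fst a \<noteq> fst b \<or> snd a \<noteq> snd b"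
    using \<open>a \<noteq> b\<close> by (simp add: prod_eq_iff)
  ultimately show ?thesis
    unfolding profile_less_def by (auto simp: nat_neq_iff)
qed

section \<open>Leading profiles, reduction and finite generation\<close>

definition leads :: "nat \<Rightarrow> 's list \<Rightarrow> ('s profile \<Rightarrow>\<^sub>0 'k::zero) \<Rightarrow> 's profile \<Rightarrow> bool"
  where "leads n xs F w \<longleftrightarrow> w \<in> Poly_Mapping.keys F \<and>
    (\<forall>w'\<in>Poly_Mapping.keys F. w' = w \<or> profile_less n xs w' w)"

lemma leads_exists:
  assumes "F \<noteq> 0" "Poly_Mapping.keys F \<subseteq> profiles n (set xs)"
  shows "\<exists>w. leads n xs F w"
proof -
  have "\<exists>w\<in>A. \<forall>w'\<in>A. w' = w \<or> profile_less n xs w' w"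
    if "finite A" "A \<noteq> {}" "A \<subseteq> profiles n (set xs)" for A
    using that
  proof (induction rule: finite_ne_induct)
    case (insert a A)
    then obtain w where w: "w \<in> A" "\<forall>w'\<in>A. w' = w \<or> profile_less n xs w' w" by auto
    have "a \<notin> A \<Longrightarrow> a \<noteq> w" using w(1) by auto
    then consider "profile_less n xs a w" | "profile_less n xs w a"
      using profile_less_total[of a n xs w] insert.hyps insert.prems w(1) by auto
    then show ?case
    proof cases
      case 1
      then show ?thesis using w by (intro bexI[of _ w]) auto
    next
      case 2
      have "profile_less n xs w' a" if "w' \<in> A" for w'
        using w(2) that 2 profile_less_trans[of n xs w' w a] by auto
      then show ?thesis by (intro bexI[of _ a]) auto
    qed
  qed simp
  from this[OF _ _ assms(2)] assms(1) show ?thesis by (auto simp: leads_def keys_eq_empty)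
qed

lemma keys_push_profile:
  assumes "Poly_Mapping.keys p \<subseteq> monomials (S \<rightarrow>\<^sub>E {1..n})"
  shows "Poly_Mapping.keys (push_keys (profile S) p) \<subseteq> profiles n S"
  using keys_push_keys[of "profile S" p] assms profile_in_profiles by blast

text \<open>One division step. The surjection obtained from \<open>emb\<close> preserves the term
  order, so the pullback of \<open>g\<close> is led by the pullback of \<open>(d, u)\<close>. The
  quotient of \<open>(e, w)\<close> by it is the profile of a monomial \<open>m\<close>, and
  \<open>c\<close> matches the leading coefficients.\<close>

lemma reduce_leading_term:
  fixes f g :: "('s \<Rightarrow> nat, 'k::field) mpoly"
  assumes "distinct xs"
    and f: "Poly_Mapping.keys f \<subseteq> monomials (set xs \<rightarrow>\<^sub>E {1..n})"
      "leads n xs (push_keys (profile (set xs)) f) (e, w)"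
    and g: "Poly_Mapping.keys g \<subseteq> monomials (set ys \<rightarrow>\<^sub>E {1..n})"
      "leads n ys (push_keys (profile (set ys)) g) (d, u)"
    and "d \<le> e" and emb: "surj_emb (\<lambda>a b. \<forall>i\<in>{1..n}. a i \<le> b i) (map u ys) (map w xs)"
  shows "\<exists>\<pi>\<in>set xs \<rightarrow>\<^sub>E set ys. \<exists>m\<in>monomials (set xs \<rightarrow>\<^sub>E {1..n}). \<exists>c. \<forall>w'\<in>Poly_Mapping.keys
    (push_keys (profile (set xs)) (f - Poly_Mapping.single m c * tensor_pull (set xs) (set ys) \<pi> g)).
    profile_less n xs w' (e, w)"
proof -
  define S where "S = set xs"
  define T where "T = set ys"
  define F where "F = push_keys (profile S) f"
  define G where "G = push_keys (profile T) g"
  obtain \<pi> where \<pi>: "\<pi> \<in> S \<rightarrow>\<^sub>E T" and le: "\<forall>s\<in>S. \<forall>i\<in>{1..n}. u (\<pi> s) i \<le> w s i"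
    and lex: "\<forall>p q. lex_less (letter_less n) ys p q \<longrightarrow> lex_less (letter_less n) xs (\<lambda>s. p (\<pi> s)) (\<lambda>s. q (\<pi> s))"
    using surj_emb_map[OF emb \<open>distinct xs\<close>, of "letter_less n"] unfolding S_def T_def by blast
  define \<rho> where "\<rho> = profile_pull S \<pi>"
  have \<rho>_less: "profile_less n xs (\<rho> a) (\<rho> b)" if "profile_less n ys a b" for a b
  proof -
    have "lex_less (letter_less n) xs (snd (\<rho> a)) (snd (\<rho> b))" if "lex_less (letter_less n) ys (snd a) (snd b)"
      using lex that
      by (subst lex_less_cong[where p' = "\<lambda>s. snd a (\<pi> s)" and q' = "\<lambda>s. snd b (\<pi> s)"])
        (auto simp: \<rho>_def profile_pull_def S_def)
    then show ?thesis using that by (auto simp: profile_less_def \<rho>_def profile_pull_def)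
  qed
  have du: "(d, u) \<in> profiles n T" "(d, u) \<in> Poly_Mapping.keys G"
    using g keys_push_profile[of g "set ys" n] by (auto simp: leads_def T_def G_def)
  have ew: "(e, w) \<in> profiles n S" "(e, w) \<in> Poly_Mapping.keys F"
    using f keys_push_profile[of f "set xs" n] by (auto simp: leads_def S_def F_def)
  define v where "v = snd (\<rho> (d, u))"
  have v_eq: "v s i = (if s \<in> S then u (\<pi> s) i else 0)" for s i
    by (simp add: v_def \<rho>_def profile_pull_def)
  have v_zero: "v s i = 0" if "s \<notin> S \<or> i \<notin> {1..n}" for s i
    using that du(1) by (auto simp: v_eq profiles_def)
  have v_le: "v s i \<le> w s i" for s i
    using le v_zero[of s i] by (cases "s \<in> S \<and> i \<in> {1..n}") (auto simp: v_eq)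
  have v_sum: "(\<Sum>i=1..n. v s i) = d" if "s \<in> S" for s
    using that du(1) PiE_mem[OF \<pi> that] by (auto simp: v_eq profiles_def)
  \<comment> \<open>The profile of the missing cofactor: \<open>v\<close> has letter sums
    \<open>d\<close> and \<open>w\<close> has letter sums \<open>e\<close>, so every letter here has
    sum \<open>e - d\<close>.\<close>
  define z where "z = (e - d, \<lambda>s i. w s i - v s i)"
  have "(\<Sum>i=1..n. w s i - v s i) = e - d" if "s \<in> S" for s
  proof -
    have "(\<Sum>i=1..n. w s i - v s i) = (\<Sum>i=1..n. w s i) - (\<Sum>i=1..n. v s i)"
      by (rule sum_subtractf_nat) (rule v_le)
    moreover have "(\<Sum>i=1..n. w s i) = e" using ew(1) that by (auto simp: profiles_def)
    ultimately show ?thesis using v_sum[OF that] by simp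
  qed
  moreover have "w s i = 0" if "s \<notin> S \<or> i \<notin> {1..n}" for s i
    using ew(1) that by (auto simp: profiles_def)
  ultimately have "z \<in> profiles n S" by (auto simp: profiles_def z_def)
  then obtain m where m: "m \<in> monomials (S \<rightarrow>\<^sub>E {1..n})" "profile S m = z"
    using profiles_realize[of "e - d" "\<lambda>s i. w s i - v s i" n S] by (auto simp: z_def)
  have z_\<rho>: "z + \<rho> (d, u) = (e, w)"
  proof -
    have "\<rho> (d, u) = (d, v)" by (simp add: v_def \<rho>_def profile_pull_def)
    then show ?thesis using \<open>d \<le> e\<close> v_le by (simp add: z_def fun_eq_iff)
  qed
  define c where "c = Poly_Mapping.lookup F (e, w) / Poly_Mapping.lookup G (d, u)"
  define H where "H = push_keys (profile S) (Poly_Mapping.single m c * tensor_pull S T \<pi> g)"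
  \<comment> \<open>In the monoid algebra of profiles, multiplication by \<open>m\<close> is
    translation by \<open>z\<close>, and pullback of polynomials becomes \<rho>.\<close>
  have "H = Poly_Mapping.single z c * push_keys \<rho> G"
    unfolding H_def G_def tensor_pull_eq
    by (simp add: push_keys_mult profile_add m(2) push_keys_push_keys profile_push_keys[OF \<pi>] \<rho>_def)
  then have H: "H = (\<Sum>x\<in>Poly_Mapping.keys G. Poly_Mapping.single (z + \<rho> x) (c * Poly_Mapping.lookup G x))"
    by (simp add: push_keys_def sum_distrib_left mult_single)
  \<comment> \<open>Both \<rho> and translation by \<open>z\<close> preserve the strict order. Hence
    no other term of \<open>G\<close> reaches \<open>(e, w)\<close>, and the coefficient there
    cannot be disturbed.\<close>
  have less: "profile_less n xs (z + \<rho> x) (e, w)" if "x \<in> Poly_Mapping.keys G" "x \<noteq> (d, u)" for x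
  proof -
    have "profile_less n ys x (d, u)" using that g(2) by (auto simp: leads_def G_def T_def)
    then show ?thesis unfolding z_\<rho>[symmetric] by (intro profile_less_add \<rho>_less)
  qed
  have "Poly_Mapping.lookup H (e, w) =
      (\<Sum>x\<in>Poly_Mapping.keys G. if x = (d, u) then c * Poly_Mapping.lookup G (d, u) else 0)"
    unfolding H lookup_sum
  proof (rule sum.cong)
    fix x assume x: "x \<in> Poly_Mapping.keys G"
    show "Poly_Mapping.lookup (Poly_Mapping.single (z + \<rho> x) (c * Poly_Mapping.lookup G x)) (e, w) =
        (if x = (d, u) then c * Poly_Mapping.lookup G (d, u) else 0)"
    proof (cases "x = (d, u)")
      case True
      then show ?thesis by (simp add: z_\<rho>)
    next
      case False
      then have "z + \<rho> x \<noteq> (e, w)" using less[OF x] profile_less_irrefl by metis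
      then show ?thesis using False by (simp add: lookup_single)
    qed
  qed simp
  also have "\<dots> = Poly_Mapping.lookup F (e, w)"
    using du(2) by (simp add: c_def in_keys_iff)
  finally have lookup_H: "Poly_Mapping.lookup H (e, w) = Poly_Mapping.lookup F (e, w)" .
  have "profile_less n xs w' (e, w)" if w': "w' \<in> Poly_Mapping.keys (F - H)" for w'
  proof -
    have "w' \<noteq> (e, w)" using w' lookup_H by (auto simp: in_keys_iff lookup_minus)
    have "w' \<in> Poly_Mapping.keys F \<or> w' \<in> Poly_Mapping.keys H"
      using w' Poly_Mapping.keys_diff[of F H] by blast
    then show ?thesis
    proof
      assume "w' \<in> Poly_Mapping.keys F"
      then show ?thesis using f(2) \<open>w' \<noteq> (e, w)\<close> by (auto simp: leads_def F_def S_def)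
    next
      assume "w' \<in> Poly_Mapping.keys H"
      then obtain x where "x \<in> Poly_Mapping.keys G" "w' = z + \<rho> x"
        using keys_sum[of "\<lambda>x. Poly_Mapping.single (z + \<rho> x) (c * Poly_Mapping.lookup G x)" "Poly_Mapping.keys G"]
        by (auto simp: H[symmetric] split: if_splits)
      then show ?thesis using less[of x] z_\<rho> \<open>w' \<noteq> (e, w)\<close> by auto
    qed
  qed
  then have "\<forall>w'\<in>Poly_Mapping.keys (push_keys (profile S) (f - Poly_Mapping.single m c * tensor_pull S T \<pi> g)).
      profile_less n xs w' (e, w)"
    by (simp add: push_keys_diff F_def H_def)
  then show ?thesis using \<pi> m(1) unfolding S_def T_def by blast
qed

text \<open>A Groebner basis argument: the leading words of the polynomials in \<open>G\<close> form
  a finite basis of all leading words of \<open>J\<close>. Reduction ends when the image in the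
  monoid algebra of profiles is zero, and by \<open>kernel_subset\<close> the remainder then lies in
  the rank-one ideal.\<close>

lemma rank_one_ideals_finitely_generated:
  fixes J :: "'s set \<Rightarrow> ('s \<Rightarrow> nat, 'k::field) mpoly set"
  assumes J: "fin_op_ideal (tensor_algebra n) tensor_pull J"
    and I_J: "\<forall>S. finite S \<longrightarrow> rank_one_ideal n S \<subseteq> J S"
  shows "\<exists>G. finite G \<and> (\<forall>(T, b)\<in>G. finite T \<and> b \<in> J T) \<and>
    (\<forall>S H. finite S \<longrightarrow> ideal H (tensor_algebra n S) \<longrightarrow> rank_one_ideal n S \<subseteq> H \<longrightarrow>
      {tensor_pull S T \<pi> b |T b \<pi>. (T, b) \<in> G \<and> \<pi> \<in> S \<rightarrow>\<^sub>E T} \<subseteq> H \<longrightarrow> J S \<subseteq> H)"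
proof -
  have J_ideal: "mpoly_ideal (S \<rightarrow>\<^sub>E {1..n}) (J S)" if "finite S" for S
    using J that unfolding mpoly_ideal_def fin_op_ideal_def tensor_algebra_def by blast
  have J_pull: "tensor_pull S T \<pi> p \<in> J S" if "finite S" "finite T" "\<pi> \<in> S \<rightarrow>\<^sub>E T" "p \<in> J T" for S T \<pi> p
    using J that unfolding fin_op_ideal_def by blast
  define leading where "leading xs p d u \<longleftrightarrow>
    distinct xs \<and> p \<in> J (set xs) \<and> leads n xs (push_keys (profile (set xs)) p) (d, u)" for xs p d u
  define W where "W = {(d, map u xs) |d u xs. \<exists>p. leading xs p d u}"
  \<comment> \<open>The degree is compared separately because an empty word carries no information
    about it.\<close>
  define emb where "emb a b \<longleftrightarrow> fst a \<le> fst b \<and> surj_emb (\<lambda>a b. \<forall>i\<in>{1..n}. a i \<le> b i) (snd a) (snd b)"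
    for a b :: "nat \<times> (nat \<Rightarrow> nat) list"
  have "wqo emb"
    unfolding emb_def by (rule wqo_conj[OF wqo_le_wellorder wqo_surj_emb]) simp
  then obtain W\<^sub>0 where W\<^sub>0: "W\<^sub>0 \<subseteq> W" "finite W\<^sub>0" "\<forall>w\<in>W. \<exists>w\<^sub>0\<in>W\<^sub>0. emb w\<^sub>0 w"
    using wqo_finite_basis[of emb W] by blast
  have "\<forall>w\<in>W\<^sub>0. \<exists>t. case t of (xs, p, d, u) \<Rightarrow> w = (d, map u xs) \<and> leading xs p d u"
    using W\<^sub>0(1) unfolding W_def by fastforce
  from bchoice[OF this]
  obtain pick where pick: "\<forall>w\<in>W\<^sub>0. case pick w of (xs, p, d, u) \<Rightarrow> w = (d, map u xs) \<and> leading xs p d u" ..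
  define G where "G = (\<lambda>w. case pick w of (xs, p, d, u) \<Rightarrow> (set xs, p)) ` W\<^sub>0"
  have generator: "\<exists>ys g d' u'. (set ys, g) \<in> G \<and> leading ys g d' u' \<and> d' \<le> d \<and>
      surj_emb (\<lambda>a b. \<forall>i\<in>{1..n}. a i \<le> b i) (map u' ys) (map u xs)" if "leading xs p d u" for xs p d u
  proof -
    have "(d, map u xs) \<in> W" using that by (auto simp: W_def)
    then obtain w where w: "w \<in> W\<^sub>0" "emb w (d, map u xs)" using W\<^sub>0(3) by blast
    obtain ys g d' u' where "pick w = (ys, g, d', u')" by (rule prod_cases4)
    moreover from this have "w = (d', map u' ys)" "leading ys g d' u'" using pick w(1) by auto
    moreover have "(set ys, g) \<in> G" using calculation(1) w(1) by (force simp: G_def)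
    ultimately show ?thesis using w(2) by (auto simp: emb_def)
  qed
  show ?thesis
  proof (intro exI[of _ G] conjI allI impI)
    show "finite G" using W\<^sub>0(2) by (simp add: G_def)
    show "\<forall>(T, b)\<in>G. finite T \<and> b \<in> J T"
    proof clarify
      fix T b assume "(T, b) \<in> G"
      then obtain w where w: "w \<in> W\<^sub>0" "(T, b) = (case pick w of (xs, p, d, u) \<Rightarrow> (set xs, p))"
        by (auto simp: G_def)
      obtain ys g d' u' where "pick w = (ys, g, d', u')" by (rule prod_cases4)
      then show "finite T \<and> b \<in> J T" using pick w by (auto simp: leading_def)
    qed
  next
    fix S H
    assume S: "finite S" and H: "ideal H (tensor_algebra n S :: ('k, ('s \<Rightarrow> nat, 'k) mpoly) module)"
      and I_H: "rank_one_ideal n S \<subseteq> H"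
      and G_H: "{tensor_pull S T \<pi> b |T b \<pi>. (T, b) \<in> G \<and> \<pi> \<in> S \<rightarrow>\<^sub>E T} \<subseteq> H"
    interpret H: mpoly_ideal "S \<rightarrow>\<^sub>E {1..n}" H
      using H unfolding mpoly_ideal_def tensor_algebra_def .
    interpret JS: mpoly_ideal "S \<rightarrow>\<^sub>E {1..n}" "J S"
      using S by (rule J_ideal)
    interpret rank_one_ideal_at n S "rank_one_ideal n S :: ('s \<Rightarrow> nat, 'k) mpoly set"
      using S by unfold_locales
    obtain xs where xs: "set xs = S" "distinct xs" using finite_distinct_list[OF S] by blast
    have reduced: "p \<in> H" if "p \<in> J S" "push_keys (profile S) p = 0" for p
      using kernel_subset that JS.subset_carrier I_H by blast
    \<comment> \<open>For the fixed enumeration \<open>xs\<close> the order on profiles is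
      well-founded, so repeated subtraction of multiples of pulled back generators
      terminates.\<close>
    have main: "\<forall>p\<in>J S. leads n xs (push_keys (profile S) p) a \<longrightarrow> p \<in> H" for a
    proof (induction a rule: wf_induct_rule[OF wf_profile_less[of n xs]])
      case (1 a)
      show ?case
      proof (intro ballI impI)
        fix p assume p: "p \<in> J S" "leads n xs (push_keys (profile S) p) a"
        obtain d u where a: "a = (d, u)" by (cases a)
        have "leading xs p d u" using p xs a by (simp add: leading_def)
        then obtain ys g d' u' where g: "(set ys, g) \<in> G" "leading ys g d' u'" "d' \<le> d"
          "surj_emb (\<lambda>a b. \<forall>i\<in>{1..n}. a i \<le> b i) (map u' ys) (map u xs)"
          using generator by blast
        have g_J: "g \<in> J (set ys)" using g(2) by (simp add: leading_def)
        have "\<exists>\<pi>\<in>set xs \<rightarrow>\<^sub>E set ys. \<exists>m\<in>monomials (set xs \<rightarrow>\<^sub>E {1..n}). \<exists>c. \<forall>w'\<in>Poly_Mapping.keys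
            (push_keys (profile (set xs)) (p - Poly_Mapping.single m c * tensor_pull (set xs) (set ys) \<pi> g)).
            profile_less n xs w' (d, u)"
        proof (rule reduce_leading_term)
          show "Poly_Mapping.keys g \<subseteq> monomials (set ys \<rightarrow>\<^sub>E {1..n})"
            by (rule mpoly_ideal.subset_carrier[OF J_ideal g_J]) simp
        qed (use xs p a g JS.subset_carrier in \<open>auto simp: leading_def\<close>)
        then obtain \<pi> m c where \<pi>: "\<pi> \<in> S \<rightarrow>\<^sub>E set ys" and m: "m \<in> monomials (S \<rightarrow>\<^sub>E {1..n})"
          and less: "\<forall>w'\<in>Poly_Mapping.keys
            (push_keys (profile S) (p - Poly_Mapping.single m c * tensor_pull S (set ys) \<pi> g)).
            profile_less n xs w' a"
          unfolding xs(1) a by blast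
        define h where "h = Poly_Mapping.single m c * tensor_pull S (set ys) \<pi> g"
        have "tensor_pull S (set ys) \<pi> g \<in> H" using G_H g(1) \<pi> by blast
        then have "h \<in> H" unfolding h_def using m by (rule H.single_mult_closed)
        \<comment> \<open>Membership in \<open>J S\<close> keeps the remainder within reach of the
          induction hypothesis; membership in \<open>H\<close> allows \<open>p\<close> to be
          recovered from it.\<close>
        have "h \<in> J S" unfolding h_def using J_pull[OF S _ \<pi> g_J] m by (intro JS.single_mult_closed) simp_all
        then have q: "p - h \<in> J S" using p(1) by (intro JS.diff_closed)
        have "p - h \<in> H"
        proof (cases "push_keys (profile S) (p - h) = 0")
          case True
          with q show ?thesis by (rule reduced)
        next
          case False
          then obtain b where b: "leads n xs (push_keys (profile S) (p - h)) b"
            using leads_exists[of "push_keys (profile S) (p - h)" n xs]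
              keys_push_profile[OF JS.subset_carrier[OF q]] xs(1) by blast
          then have "profile_less n xs b a" using less by (simp add: leads_def h_def)
          then show ?thesis using 1 q b by blast
        qed
        then have "(p - h) + h \<in> H" using \<open>h \<in> H\<close> by (rule H.add_closed)
        then show "p \<in> H" by simp
      qed
    qed
    show "J S \<subseteq> H"
    proof
      fix p assume p: "p \<in> J S"
      show "p \<in> H"
      proof (cases "push_keys (profile S) p = 0")
        case True
        with p show ?thesis by (rule reduced)
      next
        case False
        then obtain a where "leads n xs (push_keys (profile S) p) a"
          using leads_exists[of "push_keys (profile S) p" n xs]
            keys_push_profile[OF JS.subset_carrier[OF p]] xs(1) by blast
        then show ?thesis using main p by blast
      qed
    qed
  qed
qed

theorem theorem3p2:
  fixes n :: nat
  shows "noetherian_fin_op_algebra (ring_of_type_algebra :: 'k::field ring)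
    (rank_one_algebra n :: 's::infinite set \<Rightarrow> ('k, ('s \<Rightarrow> nat, 'k) mpoly set) module)
    (rank_one_pull n)"
proof -
  interpret fin_op_algebra_with_ideal "ring_of_type_algebra :: 'k ring"
      "tensor_algebra n :: 's set \<Rightarrow> ('k, ('s \<Rightarrow> nat, 'k) mpoly) module" tensor_pull "rank_one_ideal n"
    by (intro fin_op_algebra_with_ideal.intro fin_op_algebra_with_ideal_axioms.intro
        tensor_fin_op_algebra rank_one_fin_op_ideal)
  show ?thesis
    unfolding rank_one_algebra_def rank_one_pull_def
    by (rule quot_noetherian) (rule rank_one_ideals_finitely_generated)
qed

end
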